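(* Every $2$-saturated subcubic graph $G$ such that $g_3(G)=3$ is $(1,2,2,2)$-packing colorable.
   Context: All graphs are finite, simple and undirected. For a non-decreasing sequence $S=(s_1,\dots,s_k)$ of positive integers, an $S$-packing coloring of $G$ is a partition of $V(G)$ into sets $V_1,\dots,V_k$ such that any two distinct vertices $u,v\in V_i$ satisfy $dist_G(u,v)>s_i$; $G$ is $S$-packing colorable if it admits one. $G$ is subcubic if its maximum degree is at most $3$. A subcubic graph is $k$-saturated if every vertex of degree $3$ is adjacent to at most $k$ vertices of degree $3$. The local girth $g(v)$ of a vertex $v$ is the length of a shortest cycle containing $v$ ($\infty$ if none), and $g_3(G)=\max\{g(v): d_G(v)=3\}$. *)

theory Defs
  imports
    "Graph_Theory.Graph_Theory"
    "HOL-Library.Extended_Nat"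
    "HOL-Library.Disjoint_Sets"
begin

text \<open>
  Finite simple undirected graphs are the symmetric, loop-free digraphs without parallel arcs
  of the locale \<^locale>\<open>graph\<close>: an edge \<open>uv\<close> is represented by the two arcs \<open>(u, v)\<close> and
  \<open>(v, u)\<close>. Hence the degree of a vertex is its out-degree.
\<close>

abbreviation vdegree :: "('a, 'b) pre_digraph \<Rightarrow> 'a \<Rightarrow> nat" where
  "vdegree G v \<equiv> out_degree G v"

abbreviation graph_dist :: "('a, 'b) pre_digraph \<Rightarrow> 'a \<Rightarrow> 'a \<Rightarrow> ereal" where
  "graph_dist G u v \<equiv> wf_digraph.\<mu> G (\<lambda>_. 1) u v"

definition subcubic :: "('a, 'b) pre_digraph \<Rightarrow> bool" where
  "subcubic G \<longleftrightarrow> (\<forall>v \<in> verts G. vdegree G v \<le> 3)"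

definition saturated :: "nat \<Rightarrow> ('a, 'b) pre_digraph \<Rightarrow> bool" where
  "saturated k G \<longleftrightarrow>
     (\<forall>v \<in> verts G. vdegree G v = 3 \<longrightarrow> card {u \<in> verts G. v \<rightarrow>\<^bsub>G\<^esub> u \<and> vdegree G u = 3} \<le> k)"

text \<open>
  Closed walks \<open>u, v, u\<close> are cycles in the sense of \<^const>\<open>pre_digraph.cycle\<close>; the length bound
  excludes them, leaving exactly the cycles of the undirected graph.
\<close>

definition undirected_cycle :: "('a, 'b) pre_digraph \<Rightarrow> 'b awalk \<Rightarrow> bool" where
  "undirected_cycle G p \<longleftrightarrow> pre_digraph.cycle G p \<and> 3 \<le> length p"

text \<open>The infimum over the empty set is \<open>\<infinity>\<close>.\<close>

definition local_girth :: "('a, 'b) pre_digraph \<Rightarrow> 'a \<Rightarrow> enat" where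
  "local_girth G v = (INF p \<in> {p. undirected_cycle G p \<and> v \<in> tail G ` set p}. enat (length p))"

text \<open>
  For a finite graph the supremum is a maximum whenever there is a vertex of degree 3. Without
  such a vertex it is 0, so that \<open>g3 G = 3\<close> implies that there is one.
\<close>

definition g3 :: "('a, 'b) pre_digraph \<Rightarrow> enat" where
  "g3 G = (SUP v \<in> {v \<in> verts G. vdegree G v = 3}. local_girth G v)"

text \<open>
  The sequence \<open>S\<close> is indexed from 0. As usual for colorings, classes \<open>V i\<close> may be empty.
  The definition is meant for non-decreasing sequences of positive integers.
\<close>

definition packing_coloring :: "nat list \<Rightarrow> ('a, 'b) pre_digraph \<Rightarrow> (nat \<Rightarrow> 'a set) \<Rightarrow> bool" where
  "packing_coloring S G V \<longleftrightarrow>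
     (\<Union>i<length S. V i) = verts G \<and>
     disjoint_family_on V {..<length S} \<and>
     (\<forall>i<length S. \<forall>u \<in> V i. \<forall>v \<in> V i. u \<noteq> v \<longrightarrow> ereal (real (S ! i)) < graph_dist G u v)"

definition packing_colorable :: "nat list \<Rightarrow> ('a, 'b) pre_digraph \<Rightarrow> bool" where
  "packing_colorable S G \<longleftrightarrow> (\<exists>V. packing_coloring S G V)"

end

theory Submission
  imports Defs
begin

text \<open>
  Induct on the number of vertices over subcubic graphs in which every vertex of degree 3 lies in a
  triangle and has a neighbour of degree at most 2; this class is closed under vertex deletion. A
  vertex of degree at most 1 and a diamond can be deleted, a path of three vertices of degree 2 can
  be contracted, and two triangles joined by an edge between vertices of degree 3 can be replaced by
  a single vertex: each time a coloring of the smaller graph extends.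

  In an irreducible graph the vertices outside triangles form paths with one or two vertices, whose
  ends are attached to vertices of degree 3. Let all triangles use the colors 0, 1, 2 (where 0 is
  the class of radius 1) and all these paths the colors 0 and 3. The only obstructions are that the
  vertex of color 0 in a triangle needs a neighbour of color 3 outside the triangle, while a path
  of two vertices has only one vertex of color 3, and that the two triangle vertices joined by a
  path of one vertex must not share the color 1 or 2. Both are resolved by 2-coloring a union of two
  matchings.
\<close>

section \<open>Colorings in terms of neighbourhoods\<close>

text \<open>Adjacency is given by neighbourhoods, so that the reductions become function updates,
  intersections and images. A triangle at \<open>t\<close> is a pair of adjacent neighbours of
  \<open>t\<close>; saturation becomes a neighbour of degree at most 2.\<close>

definition admissible :: "'a set \<Rightarrow> ('a \<Rightarrow> 'a set) \<Rightarrow> bool" where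
  "admissible V N \<longleftrightarrow> finite V \<and>
     (\<forall>t\<in>V. N t \<subseteq> V \<and> t \<notin> N t \<and> card (N t) \<le> 3 \<and>
        (card (N t) = 3 \<longrightarrow> (\<exists>u\<in>N t. \<exists>w\<in>N t. u \<in> N w) \<and> (\<exists>u\<in>N t. card (N u) \<le> 2))) \<and>
     (\<forall>u\<in>V. \<forall>w\<in>V. u \<in> N w \<longrightarrow> w \<in> N u)"

text \<open>
  Color 0 is the class of radius 1, the colors 1, 2 and 3 are those of radius 2. Two vertices at
  distance 2 are seen from their common neighbour \<open>t\<close>.
\<close>

definition valid_at :: "('a \<Rightarrow> 'a set) \<Rightarrow> ('a \<Rightarrow> nat) \<Rightarrow> 'a \<Rightarrow> bool" where
  "valid_at N f t \<longleftrightarrow> f t < 4 \<and> (\<forall>u\<in>N t. f u \<noteq> f t) \<and>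
     (\<forall>u\<in>N t. \<forall>w\<in>N t. u \<noteq> w \<longrightarrow> f u = f w \<longrightarrow> f u = 0)"

definition colorable :: "'a set \<Rightarrow> ('a \<Rightarrow> 'a set) \<Rightarrow> bool" where
  "colorable V N \<longleftrightarrow> (\<exists>f. \<forall>t\<in>V. valid_at N f t)"

lemma admissibleD:
  assumes "admissible V N"
  shows "finite V"
    and "t \<in> V \<Longrightarrow> N t \<subseteq> V" and "t \<in> V \<Longrightarrow> finite (N t)" and "t \<in> V \<Longrightarrow> t \<notin> N t"
    and "t \<in> V \<Longrightarrow> card (N t) \<le> 3"
    and "t \<in> V \<Longrightarrow> card (N t) = 3 \<Longrightarrow> \<exists>u\<in>N t. \<exists>w\<in>N t. u \<in> N w"
    and "t \<in> V \<Longrightarrow> card (N t) = 3 \<Longrightarrow> \<exists>u\<in>N t. card (N u) \<le> 2"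
    and "w \<in> V \<Longrightarrow> u \<in> N w \<Longrightarrow> w \<in> N u"
    and "w \<in> V \<Longrightarrow> u \<in> N w \<Longrightarrow> u \<in> V"
proof -
  show fin: "finite V" using assms by (simp add: admissible_def)
  have main: "N t \<subseteq> V \<and> t \<notin> N t \<and> card (N t) \<le> 3 \<and>
      (card (N t) = 3 \<longrightarrow> (\<exists>u\<in>N t. \<exists>w\<in>N t. u \<in> N w) \<and> (\<exists>u\<in>N t. card (N u) \<le> 2))"
    if "t \<in> V" for t
    using assms that by (simp add: admissible_def)
  show sub: "t \<in> V \<Longrightarrow> N t \<subseteq> V" for t using main by simp
  show "t \<in> V \<Longrightarrow> finite (N t)" using sub fin by (meson finite_subset)
  show "t \<in> V \<Longrightarrow> t \<notin> N t" "t \<in> V \<Longrightarrow> card (N t) \<le> 3" using main by simp_all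
  show "t \<in> V \<Longrightarrow> card (N t) = 3 \<Longrightarrow> \<exists>u\<in>N t. \<exists>w\<in>N t. u \<in> N w"
    "t \<in> V \<Longrightarrow> card (N t) = 3 \<Longrightarrow> \<exists>u\<in>N t. card (N u) \<le> 2" using main by simp_all
  show mem: "w \<in> V \<Longrightarrow> u \<in> N w \<Longrightarrow> u \<in> V" using sub by blast
  show "w \<in> V \<Longrightarrow> u \<in> N w \<Longrightarrow> w \<in> N u" using assms mem by (simp add: admissible_def)
qed

text \<open>A vertex that still has degree 3 has lost no neighbour, so its triangle and its
  neighbour of low degree survive.\<close>

lemma admissible_induced:
  assumes "admissible V N" "W \<subseteq> V"
  shows "admissible W (\<lambda>t. N t \<inter> W)"
  unfolding admissible_def
proof (intro conjI ballI impI)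
  note A = admissibleD[OF assms(1)]
  show "finite W" using A(1) assms(2) by (rule finite_subset[rotated])
  fix t assume t: "t \<in> W"
  then have tV: "t \<in> V" using assms(2) by blast
  show "N t \<inter> W \<subseteq> W" by blast
  show "t \<notin> N t \<inter> W" using A(4) tV by blast
  show "card (N t \<inter> W) \<le> 3"
    using A(3,5)[OF tV] card_mono[of "N t" "N t \<inter> W"] by force
  {
    assume c: "card (N t \<inter> W) = 3"
    have sub: "N t \<inter> W = N t"
      using card_seteq[OF A(3)[OF tV] Int_lower1] A(5)[OF tV] c by simp
    then have c3: "card (N t) = 3" using c by simp
    show "\<exists>u\<in>N t \<inter> W. \<exists>w\<in>N t \<inter> W. u \<in> N w \<inter> W"
      using A(6)[OF tV c3] sub by blast
    obtain u where u: "u \<in> N t" "card (N u) \<le> 2" using A(7)[OF tV c3] by blast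
    then have "card (N u \<inter> W) \<le> 2"
      using A(3)[OF A(9)[OF tV u(1)]] card_mono[of "N u" "N u \<inter> W"] by force
    then show "\<exists>u\<in>N t \<inter> W. card (N u \<inter> W) \<le> 2" using u sub by blast
  }
next
  fix u w assume "u \<in> W" "w \<in> W" "u \<in> N w \<inter> W"
  then show "w \<in> N u \<inter> W" using admissibleD(8)[OF assms(1)] assms(2) by blast
qed

text \<open>Color 0 may repeat around \<open>t\<close>, so neighbours can be turned to 0 without
  harm unless \<open>t\<close> itself has color 0. The map \<open>r\<close> sends a neighbour to the
  vertex that stands for it in the smaller graph; it differs from the identity only where two
  triangles collapse to one vertex.\<close>

lemma valid_at_transfer:
  assumes "valid_at N' f t" "inj_on r (N t)" "r ` N t \<subseteq> N' t" "f' t = f t"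
    and "\<And>s. s \<in> N t \<Longrightarrow> f' s = f (r s) \<or> f' s = 0 \<and> f t \<noteq> 0"
  shows "valid_at N f' t"
  unfolding valid_at_def
proof (intro conjI ballI impI)
  show "f' t < 4" using assms(1,4) by (simp add: valid_at_def)
  fix u assume u: "u \<in> N t"
  show "f' u \<noteq> f' t"
    using assms(1,3,4) assms(5)[OF u] u by (fastforce simp: valid_at_def)
  fix w assume w: "w \<in> N t" and ne: "u \<noteq> w" and eq: "f' u = f' w"
  have "r u \<noteq> r w" using assms(2) u w ne by (auto dest: inj_onD)
  then show "f' u = 0"
    using assms(1,3) assms(5)[OF u] assms(5)[OF w] u w eq unfolding valid_at_def
    by (metis image_subset_iff)
qed

lemma fresh_color: "\<exists>k::nat. k < 4 \<and> k \<noteq> 0 \<and> k \<noteq> a \<and> k \<noteq> b"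
proof -
  have "\<not> {1,2,3::nat} \<subseteq> {a,b}"
    using card_mono[of "{a,b}" "{1,2,3::nat}"] by (auto simp: card_insert_if split: if_splits)
  then obtain k where "k \<in> {1,2,3::nat}" "k \<notin> {a,b}" by blast
  then show ?thesis by (intro exI[of _ k]) auto
qed

section \<open>Reducible configurations\<close>

text \<open>An isolated vertex takes 0, and so does a leaf whose neighbour \<open>u\<close> has a
  nonzero color. If \<open>u\<close> has color 0, it has at most two other neighbours, so one of 1,
  2, 3 is missing around it.\<close>

lemma colorable_delete_vertex:
  assumes adm: "admissible V N" and t: "t \<in> V" "card (N t) \<le> 1"
    and col: "colorable (V - {t}) (\<lambda>s. N s \<inter> (V - {t}))"
  shows "colorable V N"
proof -
  note A = admissibleD[OF adm]
  obtain f where f: "\<And>s. s \<in> V - {t} \<Longrightarrow> valid_at (\<lambda>s. N s \<inter> (V - {t})) f s"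
    using col unfolding colorable_def by blast
  show ?thesis
  proof (cases "N t = {}")
    case True
    have "valid_at N (f(t := 0)) s" if s: "s \<in> V" for s
    proof (cases "s = t")
      case True
      then show ?thesis using \<open>N t = {}\<close> by (simp add: valid_at_def)
    next
      case False
      have "t \<notin> N s" using A(8)[OF s] True by auto
      then show ?thesis
        using A(2)[OF s] False s by (intro valid_at_transfer[OF f[of s], where r = id]) auto
    qed
    then show ?thesis unfolding colorable_def by blast
  next
    case False
    then have "card (N t) = 1" using t A(3)[OF t(1)] by (simp add: card_gt_0_iff le_antisym Suc_leI)
    then obtain u where u: "N t = {u}" by (auto simp: card_1_singleton_iff)
    have uV: "u \<in> V" "u \<noteq> t" using A(9)[OF t(1)] A(4)[OF t(1)] u by auto
    have tu: "t \<in> N u" using A(8)[OF t(1)] u by simp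
    define M where "M = N u - {t}"
    have Nu: "N u = insert t M" "t \<notin> M" "M \<subseteq> V" using tu A(2)[OF uV(1)] by (auto simp: M_def)
    have "card M \<le> 2" using A(5)[OF uV(1)] A(3)[OF uV(1)] tu unfolding M_def by simp
    then have "card (f ` M) \<le> 2"
      using card_image_le[of M f] A(3)[OF uV(1)] by (force simp: M_def)
    then have "\<not> {1,2,3} \<subseteq> f ` M"
      using card_mono[of "f ` M" "{1,2,3}"] A(3)[OF uV(1)] by (auto simp: M_def)
    then obtain k0 where k0: "k0 \<in> {1,2,3}" "k0 \<notin> f ` M" by blast
    define k where "k = (if f u = 0 then k0 else 0)"
    have k: "k < 4" "k \<noteq> f u" "k = 0 \<or> k \<notin> f ` M" using k0 by (auto simp: k_def)
    have fu: "valid_at (\<lambda>s. N s \<inter> (V - {t})) f u" using f uV by blast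
    have "valid_at N (f(t := k)) s" if s: "s \<in> V" for s
    proof -
      consider "s = t" | "s = u" | "s \<noteq> t" "s \<noteq> u" by blast
      then show ?thesis
      proof cases
        case 1
        then show ?thesis using k u uV by (simp add: valid_at_def)
      next
        case 2
        have Mi: "N u \<inter> (V - {t}) = M" using Nu by auto
        have fM: "f u < 4" "\<And>s. s \<in> M \<Longrightarrow> f s \<noteq> f u"
          "\<And>a b. a \<in> M \<Longrightarrow> b \<in> M \<Longrightarrow> a \<noteq> b \<Longrightarrow> f a = f b \<Longrightarrow> f b = 0"
          using fu unfolding valid_at_def Mi by auto
        show ?thesis
          unfolding valid_at_def 2 Nu(1) using fM k uV Nu(2) by (auto intro: fM(3))
      next
        case 3
        have "t \<notin> N s" using A(8)[OF s] u 3 by auto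
        then show ?thesis
          using A(2)[OF s] 3 s by (intro valid_at_transfer[OF f[of s], where r = id]) auto
      qed
    qed
    then show ?thesis unfolding colorable_def by blast
  qed
qed

section \<open>Contraction of a path of three vertices of degree 2\<close>

text \<open>Here \<open>f\<close> colors the graph with the edge \<open>u w\<close> in place of the
  path \<open>u v w\<close>. If all of 1, 2, 3 are blocked for \<open>v\<close>, recoloring
  \<open>w\<close> with 0 frees the old color of \<open>w\<close>.\<close>

lemma colorable_subdivide_edge:
  assumes adm: "admissible V N" and v: "v \<in> V" "N v = {u, w}" "u \<noteq> w"
    and Nu: "N u = {v, u2}" "u2 \<noteq> v" and Nw: "N w = {v, w2}" "w2 \<noteq> v"
    and uw: "u \<notin> N w"
    and f: "\<And>s. s \<in> V - {v} \<Longrightarrow> valid_at (N(u := {w, u2}, w := {u, w2})) f s"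
    and u0: "f u = 0"
  shows "colorable V N"
proof -
  note A = admissibleD[OF adm]
  have V: "u \<in> V" "w \<in> V" "u \<noteq> v" "w \<noteq> v" using A(9)[OF v(1)] A(4)[OF v(1)] v by auto
  have ne: "u2 \<noteq> w" "w2 \<noteq> u" using uw Nw A(8)[OF V(1)] Nu by auto
  have ne2: "u2 \<noteq> u" "w2 \<noteq> w" using A(4)[OF V(1)] A(4)[OF V(2)] Nu Nw by auto
  have ou: "valid_at (N(u := {w, u2}, w := {u, w2})) f u" using f V by auto
  have ow: "valid_at (N(u := {w, u2}, w := {u, w2})) f w" using f V by auto
  have vN: "v \<notin> N s" if "s \<in> V" "s \<noteq> u" "s \<noteq> w" for s
    using A(8)[OF that(1)] v that by auto
  show ?thesis
  proof (cases "\<exists>k<4. k \<noteq> 0 \<and> k \<noteq> f w \<and> k \<noteq> f u2 \<and> k \<noteq> f w2")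
    case True
    then obtain k where k: "k < 4" "k \<noteq> 0" "k \<noteq> f w" "k \<noteq> f u2" "k \<noteq> f w2" by blast
    have "valid_at N (f(v := k)) s" if s: "s \<in> V" for s
    proof -
      consider "s = v" | "s = u" | "s = w" | "s \<noteq> v" "s \<noteq> u" "s \<noteq> w" by blast
      then show ?thesis
      proof cases
        case 4
        then show ?thesis
          using s vN[OF s] by (intro valid_at_transfer[OF f[of s], where r = id]) auto
      qed (use v(2,3) Nu Nw V ne ne2 k ou ow u0 in \<open>auto simp: valid_at_def\<close>)
    qed
    then show ?thesis unfolding colorable_def by blast
  next
    case False
    obtain k where k: "k < 4" "k \<noteq> 0" "k \<noteq> f u2" "k \<noteq> f w2" using fresh_color by blast
    \<comment> \<open>With \<open>f w2 = 0\<close>, a nonzero color that avoids \<open>f w\<close>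
      and \<open>f u2\<close> would have been available for \<open>v\<close>. Hence \<open>w\<close>
      can switch to 0.\<close>
    have w20: "f w2 \<noteq> 0"
      using False fresh_color[of "f w" "f u2"] by (metis)
    have "valid_at N (f(v := k, w := 0)) s" if s: "s \<in> V" for s
    proof -
      consider "s = v" | "s = u" | "s = w" | "s \<noteq> v" "s \<noteq> u" "s \<noteq> w" by blast
      then show ?thesis
      proof cases
        case 4
        have "s = w2" if "w \<in> N s" using A(8)[OF s that] Nw 4 by auto
        then show ?thesis
          using s 4 vN[OF s] w20 by (intro valid_at_transfer[OF f[of s], where r = id]) auto
      qed (use v(2,3) Nu Nw V ne ne2 k ou ow u0 w20 in \<open>auto simp: valid_at_def\<close>)
    qed
    then show ?thesis unfolding colorable_def by blast
  qed
qed

text \<open>The ends \<open>u\<close> and \<open>w\<close> lose \<open>v\<close> and gain each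
  other, so all degrees are kept, and no triangle contains \<open>v\<close> because its neighbours
  are not adjacent. If neither end has color 0, then \<open>v\<close> takes it; otherwise
  \<open>colorable_subdivide_edge\<close> applies with that end first.\<close>

lemma colorable_contract_path:
  assumes adm: "admissible V N" and v: "v \<in> V" "N v = {u, w}" "u \<noteq> w"
    and Nu: "N u = {v, u2}" "u2 \<noteq> v" and Nw: "N w = {v, w2}" "w2 \<noteq> v"
    and uw: "u \<notin> N w"
  defines "N' \<equiv> N(u := {w, u2}, w := {u, w2})"
  shows "admissible (V - {v}) N'" and "colorable (V - {v}) N' \<Longrightarrow> colorable V N"
proof -
  note A = admissibleD[OF adm]
  have V: "u \<in> V" "w \<in> V" "u \<noteq> v" "w \<noteq> v" using A(9)[OF v(1)] A(4)[OF v(1)] v by auto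
  have ne: "u2 \<noteq> w" "w2 \<noteq> u" using uw Nw A(8)[OF V(1)] Nu by auto
  have ne2: "u2 \<noteq> u" "w2 \<noteq> w" using A(4)[OF V(1)] A(4)[OF V(2)] Nu Nw by auto
  have V2: "u2 \<in> V" "w2 \<in> V" using A(9)[OF V(1)] A(9)[OF V(2)] Nu Nw by auto
  have vN: "v \<notin> N s" if "s \<in> V" "s \<noteq> u" "s \<noteq> w" for s
    using A(8)[OF that(1)] v that by auto
  have card': "card (N' s) = card (N s)" for s
    using Nu Nw ne by (auto simp: N'_def card_insert_if)
  show "admissible (V - {v}) N'"
    unfolding admissible_def card'
  proof (intro conjI ballI impI)
    show "finite (V - {v})" using A(1) by simp
    fix t assume "t \<in> V - {v}"
    then have t: "t \<in> V" "t \<noteq> v" by auto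
    show "N' t \<subseteq> V - {v}" using A(2)[OF t(1)] vN[OF t(1)] V V2 Nu Nw by (auto simp: N'_def)
    show "t \<notin> N' t" using A(4)[OF t(1)] ne2 v by (auto simp: N'_def)
    show "card (N t) \<le> 3" using A(5)[OF t(1)] .
    {
      assume c: "card (N t) = 3"
      then have tu: "t \<noteq> u" "t \<noteq> w" using Nu Nw by (auto simp: card_insert_if)
      then have eq: "N' t = N t" by (simp add: N'_def)
      obtain a b where ab: "a \<in> N t" "b \<in> N t" "a \<in> N b" using A(6)[OF t(1) c] by blast
      have "a \<in> N' b" using ab vN[OF t(1) tu] Nu Nw by (auto simp: N'_def)
      then show "\<exists>u\<in>N' t. \<exists>w\<in>N' t. u \<in> N' w" using eq ab by auto
      show "\<exists>u\<in>N' t. card (N u) \<le> 2" using A(7)[OF t(1) c] eq by simp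
    }
  next
    fix a b assume "a \<in> V - {v}" "b \<in> V - {v}" "a \<in> N' b"
    moreover have "u \<in> N u2" "w \<in> N w2" using A(8)[OF V(1)] A(8)[OF V(2)] Nu Nw by auto
    moreover have "a \<in> N b \<Longrightarrow> b \<in> N a" using A(8) \<open>b \<in> V - {v}\<close> by blast
    ultimately show "b \<in> N' a"
      using Nu Nw ne ne2 v by (auto simp: N'_def split: if_splits)
  qed
  assume "colorable (V - {v}) N'"
  then obtain f where f: "\<And>s. s \<in> V - {v} \<Longrightarrow> valid_at N' f s" unfolding colorable_def by blast
  have ou: "valid_at N' f u" and ow: "valid_at N' f w" using f V by auto
  consider "f u = 0" | "f w = 0" | "f u \<noteq> 0" "f w \<noteq> 0" by blast
  then show "colorable V N"
  proof cases
    case 1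
    then show ?thesis
      using colorable_subdivide_edge[where N = N and f = f, OF adm v Nu Nw uw] f unfolding N'_def by blast
  next
    case 2
    have wu: "w \<notin> N u" using Nu ne V by auto
    have Nv: "N v = {w, u}" using v by auto
    have swap: "N' = N(w := {u, w2}, u := {w, u2})"
      unfolding N'_def by (rule fun_upd_twist[OF v(3)])
    show ?thesis
      using colorable_subdivide_edge[where N = N and f = f, OF adm v(1) Nv v(3)[symmetric] Nw Nu wu] f[unfolded swap] 2 by blast
  next
    case 3
    have "valid_at N (f(v := 0)) s" if s: "s \<in> V" for s
    proof -
      consider "s = v" | "s = u" | "s = w" | "s \<noteq> v" "s \<noteq> u" "s \<noteq> w" by blast
      then show ?thesis
      proof cases
        case 4
        then show ?thesis
          using s vN[OF s] by (intro valid_at_transfer[OF f[of s], where r = id]) (auto simp: N'_def)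
      qed (use v(2,3) Nu Nw V ne ne2 3 ou ow in \<open>auto simp: valid_at_def N'_def\<close>)
    qed
    then show ?thesis unfolding colorable_def by blast
  qed
qed

section \<open>Diamonds\<close>

text \<open>Only \<open>b\<close> has a neighbour outside the diamond, and at most one. If
  \<open>b\<close> has color 0, so can \<open>a\<close>, while \<open>u\<close> and \<open>v\<close>
  take nonzero colors different from the one outside. Otherwise \<open>u\<close> takes 0, and
  \<open>v\<close> and \<open>a\<close> share the two nonzero colors other than \<open>f b\<close>,
  where \<open>v\<close> avoids the color outside.\<close>

lemma colorable_delete_diamond:
  assumes adm: "admissible V N" and V: "u \<in> V" "v \<in> V" "a \<in> V" "b \<in> V"
    and Nu: "N u = {v, a, b}" and Nv: "N v = {u, a, b}" and Na: "N a = {u, v}"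
    and "a \<noteq> b"
    and col: "colorable (V - {u, v, a}) (\<lambda>s. N s \<inter> (V - {u, v, a}))"
  shows "colorable V N"
proof -
  note A = admissibleD[OF adm]
  define W where "W = V - {u, v, a}"
  obtain f where f: "\<And>s. s \<in> W \<Longrightarrow> valid_at (\<lambda>s. N s \<inter> W) f s"
    using col unfolding colorable_def W_def by blast
  have dist: "u \<noteq> v" "u \<noteq> a" "u \<noteq> b" "v \<noteq> a" "v \<noteq> b" "a \<noteq> b"
    using A(4)[OF V(1)] A(4)[OF V(2)] Nu Nv \<open>a \<noteq> b\<close> by auto
  define C where "C = N b - {u, v}"
  have "u \<in> N b" "v \<in> N b" "a \<notin> N b"
    using A(8)[OF V(1), of b] A(8)[OF V(2), of b] A(8)[OF V(4), of a] Nu Nv Na dist by auto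
  note uvaN = this
  have "card C = card (N b) - card {u, v}"
    unfolding C_def using uvaN by (intro card_Diff_subset) auto
  then have Nb4: "card C \<le> 1" using A(5)[OF V(4)] dist(1) by simp
  have Nb1: "N b = {u, v} \<union> C" using uvaN by (auto simp: C_def)
  have Nb2: "C \<subseteq> W" using A(2)[OF V(4)] uvaN(3) by (auto simp: C_def W_def)
  have Nb3: "b \<notin> C" using A(4)[OF V(4)] by (auto simp: C_def)
  note Nb = Nb1 Nb2 Nb3 Nb4
  have "finite C" using A(3)[OF V(4)] by (simp add: C_def)
  then have "\<forall>c\<in>C. \<forall>d\<in>C. c = d" using Nb4 card_le_Suc0_iff_eq[of C] by simp
  \<comment> \<open>If \<open>C\<close> is empty, then \<open>c\<close> is arbitrary and
    \<open>f c\<close> just forbids one more color.\<close>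
  then obtain c where C: "C = {} \<or> C = {c}" by (metis equals0I insertCI singletonD subsetI subset_antisym)
  have bW: "b \<in> W" using V dist by (auto simp: W_def)
  have ob: "f b < 4" "\<And>s. s \<in> C \<Longrightarrow> f s \<noteq> f b" using f[OF bW] Nb unfolding valid_at_def by auto
  have far: "N s \<inter> {u, v, a} = {}" if "s \<in> W" "s \<noteq> b" for s
    using A(8)[of s] that Nu Nv Na unfolding W_def by blast
  have ext: "colorable V N"
    if g: "\<And>s. s \<in> W \<Longrightarrow> g s = f s" "valid_at N g u" "valid_at N g v" "valid_at N g a" "valid_at N g b" for g
  proof -
    have "valid_at N g s" if s: "s \<in> V" for s
    proof (cases "s \<in> W \<and> s \<noteq> b")
      case True
      then have "N s \<subseteq> W" using far[of s] A(2)[OF s] by (auto simp: W_def)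
      then show ?thesis
        using True g(1) by (intro valid_at_transfer[OF f[of s], where r = id]) auto
    next
      case False
      then show ?thesis using g s by (auto simp: W_def)
    qed
    then show ?thesis unfolding colorable_def by blast
  qed
  have uvaW: "u \<notin> W" "v \<notin> W" "a \<notin> W" by (auto simp: W_def)
  then have uvaC: "u \<notin> C" "v \<notin> C" "a \<notin> C" using Nb by auto
  show ?thesis
  proof (cases "f b = 0")
    case True
    obtain k where k: "k < 4" "k \<noteq> 0" "k \<noteq> f c" using fresh_color by blast
    obtain l where l: "l < 4" "l \<noteq> 0" "l \<noteq> f c" "l \<noteq> k" using fresh_color by blast
    show ?thesis
      by (rule ext[of "f(u := k, v := l, a := 0)"])
        (use k l True Nu Nv Na Nb C dist ob uvaC uvaW in \<open>auto simp: valid_at_def\<close>)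
  next
    case False
    obtain k where k: "k < 4" "k \<noteq> 0" "k \<noteq> f b" "k \<noteq> f c" using fresh_color by blast
    obtain l where l: "l < 4" "l \<noteq> 0" "l \<noteq> f b" "l \<noteq> k" using fresh_color by blast
    show ?thesis
      by (rule ext[of "f(u := 0, v := k, a := l)"])
        (use k l False Nu Nv Na Nb C dist ob uvaC uvaW in \<open>auto simp: valid_at_def\<close>)
  qed
qed

section \<open>Two triangles joined by an edge\<close>

text \<open>A set closed under neighbours is a union of components, so its coloring does not
  interact with the rest. This serves the cases where a pair of triangles closes up on
  itself.\<close>

lemma colorable_component:
  assumes adm: "admissible V N" and C: "C \<subseteq> V" "\<And>s. s \<in> C \<Longrightarrow> N s \<subseteq> C" "\<And>s. s \<in> C \<Longrightarrow> valid_at N g s"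
    and col: "colorable (V - C) (\<lambda>s. N s \<inter> (V - C))"
  shows "colorable V N"
proof -
  note A = admissibleD[OF adm]
  obtain f where f: "\<And>s. s \<in> V - C \<Longrightarrow> valid_at (\<lambda>s. N s \<inter> (V - C)) f s"
    using col unfolding colorable_def by blast
  define h where "h = (\<lambda>s. if s \<in> C then g s else f s)"
  have "valid_at N h s" if s: "s \<in> V" for s
  proof (cases "s \<in> C")
    case True
    then show ?thesis
      using C(2)[OF True] by (intro valid_at_transfer[OF C(3)[OF True], where r = id]) (auto simp: h_def)
  next
    case False
    have "N s \<inter> C = {}" using A(8)[OF s] C(2) False by blast
    then show ?thesis
      using s False A(2)[OF s] by (intro valid_at_transfer[OF f, where r = id]) (auto simp: h_def)
  qed
  then show ?thesis unfolding colorable_def by blast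
qed

text \<open>
  Here \<open>c\<close> is the color of the vertex that replaces the two triangles \<open>x y z\<close> and \<open>w p q\<close>, joined by
  the edge \<open>y w\<close>, while \<open>a\<close> and \<open>b\<close> are the colors of the outer neighbours of \<open>x\<close> and \<open>p\<close>. These
  are the two neighbours of the new vertex, so they can only agree in color 0.
\<close>

lemma triangle_pair_colors:
  fixes a b c :: nat
  assumes "a < 4" "b < 4" "c < 4" "a \<noteq> c" "b \<noteq> c" "a = b \<longrightarrow> a = 0"
  obtains fx fy fz fw fp fq where
    "fx < 4" "fy < 4" "fz < 4" "fw < 4" "fp < 4" "fq < 4"
    "fx = c \<or> fx = 0" "fp = c \<or> fp = 0" "fx \<noteq> a" "fp \<noteq> b"
    "distinct [fx, fy, fz]" "distinct [fw, fp, fq]"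
    "fy = a \<longrightarrow> a = 0" "fz = a \<longrightarrow> a = 0" "fw = b \<longrightarrow> b = 0" "fq = b \<longrightarrow> b = 0"
    "fy \<noteq> fw" "fx = fw \<longrightarrow> fx = 0" "fz = fw \<longrightarrow> fz = 0" "fp = fy \<longrightarrow> fp = 0" "fq = fy \<longrightarrow> fq = 0"
proof -
  consider "a \<noteq> 0" "b \<noteq> 0" | "a = 0" | "a \<noteq> 0" "b = 0" by blast
  then show ?thesis
  proof cases
    case 1
    obtain k where k: "k < 4" "k \<noteq> 0" "k \<noteq> a" "k \<noteq> b" using fresh_color by blast
    \<comment> \<open>The values are those of \<open>x, y, z, w, p, q\<close>. The outer colors are
      exchanged: \<open>y\<close> takes \<open>b\<close> and \<open>w\<close> takes
      \<open>a\<close>, which leaves 0 for \<open>x\<close> and \<open>p\<close>.\<close>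
    show ?thesis by (rule that[of 0 b k a 0 k]) (use 1 k assms in auto)
  next
    case 2
    \<comment> \<open>If \<open>b\<close> is nonzero, then \<open>y\<close> receives it, so that the
      color \<open>k\<close> of \<open>z\<close> and \<open>q\<close> automatically avoids
      \<open>b\<close>.\<close>
    obtain l where l: "l < 4" "l \<noteq> 0" "l \<noteq> c" "b = 0 \<or> l = b"
      using fresh_color[of c c] assms by (cases "b = 0") auto
    obtain k where k: "k < 4" "k \<noteq> 0" "k \<noteq> c" "k \<noteq> l" using fresh_color by blast
    show ?thesis by (rule that[of c l k 0 c k]) (use 2 k l assms in auto)
  next
    case 3
    obtain k where k: "k < 4" "k \<noteq> 0" "k \<noteq> c" "k \<noteq> a" using fresh_color by blast
    show ?thesis by (rule that[of c 0 k a c k]) (use 3 k assms in auto)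
  qed
qed

text \<open>\<open>X\<close> and \<open>P\<close> contain the outer neighbour of \<open>x\<close>
  and of \<open>p\<close>, if there is one. The vertex \<open>x\<close> is reused as the
  replacement, with neighbourhood \<open>X \<union> P\<close>. If \<open>x\<close> and
  \<open>p\<close> are adjacent or have a common neighbour, this would give a loop or a double edge;
  then the two triangles, with the common neighbour if any, are a whole component that is colored
  explicitly.\<close>

lemma colorable_replace_triangle_pair:
  fixes V :: "'a set"
  assumes adm: "admissible V N" and V: "y \<in> V" "w \<in> V"
    and Ny: "N y = {x, z, w}" and Nw: "N w = {p, q, y}"
    and Nz: "N z = {x, y}" and Nq: "N q = {w, p}"
    and Nx: "N x = {y, z} \<union> X" "X \<inter> {y, z} = {}" "X \<subseteq> {x'}"
    and Np: "N p = {w, q} \<union> P" "P \<inter> {w, q} = {}" "P \<subseteq> {p'}"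
    and dist: "distinct [x, y, z, w, p, q]"
    and smaller: "\<And>(W :: 'a set) M. card W < card V \<Longrightarrow> admissible W M \<Longrightarrow> colorable W M"
  shows "colorable V N"
proof -
  note A = admissibleD[OF adm]
  have VV: "x \<in> V" "z \<in> V" "p \<in> V" "q \<in> V" using A(9)[OF V(1)] A(9)[OF V(2)] Ny Nw by auto
  have XV: "X \<subseteq> V" and PV: "P \<subseteq> V" using A(2)[OF VV(1)] A(2)[OF VV(3)] Nx Np by auto
  have Xn: "s \<notin> {x, y, z, w, q}" if "s \<in> X" for s
  proof -
    have "x \<in> N s" using A(8)[OF VV(1)] Nx that by auto
    then show ?thesis using A(4)[OF VV(1)] Nx that Nw Nq dist by auto
  qed
  have Pn: "s \<notin> {p, y, z, w, q}" if "s \<in> P" for s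
  proof -
    have "p \<in> N s" using A(8)[OF VV(3)] Np that by auto
    then show ?thesis using A(4)[OF VV(3)] Np that Ny Nz dist by auto
  qed
  have col: "colorable (V - C) (\<lambda>s. N s \<inter> (V - C))" if "y \<in> C" for C
  proof (rule smaller)
    show "card (V - C) < card V" using that V A(1) by (intro psubset_card_mono) auto
    show "admissible (V - C) (\<lambda>s. N s \<inter> (V - C))" by (rule admissible_induced[OF adm]) auto
  qed
  show ?thesis
  proof (cases "p \<in> X \<or> X \<inter> P \<noteq> {}")
    case True
    then consider "p \<in> X" | d where "d \<in> X" "d \<in> P" by blast
    then show ?thesis
    proof cases
      case 1
      have "p \<in> N x" using 1 Nx by auto
      then have "x \<in> P" using A(8)[OF VV(1)] Np dist by auto
      with 1 have XP: "X = {p}" "P = {x}" using Nx(3) Np(3) by auto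
      define C where "C = {x, y, z, w, p, q}"
      define g where "g = (\<lambda>_. 0 :: nat)(y := 1, z := 3, p := 2, q := 3)"
      have g: "g x = 0" "g y = 1" "g z = 3" "g w = 0" "g p = 2" "g q = 3"
        using dist by (auto simp: g_def)
      have Nx': "N x = {y, z, p}" and Np': "N p = {w, q, x}" using Nx Np XP by auto
      have sub: "\<forall>s\<in>C. N s \<subseteq> C" by (simp add: C_def Nx' Np' Ny Nz Nw Nq)
      have okg: "\<forall>s\<in>C. valid_at N g s" by (simp add: C_def valid_at_def Nx' Np' Ny Nz Nw Nq g)
      have CV: "C \<subseteq> V" "y \<in> C" using V VV by (auto simp: C_def)
      show ?thesis
        using colorable_component[OF adm CV(1), of g] sub okg col[OF CV(2)] by blast
    next
      case 2
      then have XP: "X = {d}" "P = {d}" using Nx(3) Np(3) by auto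
      have d: "d \<notin> {x, y, z, w, p, q}" using Xn Pn 2 by auto
      have dV: "d \<in> V" using 2 XV by auto
      have xpd: "x \<in> N d" "p \<in> N d" using A(8)[OF VV(1)] A(8)[OF VV(3)] Nx Np 2 by auto
      \<comment> \<open>A third neighbour \<open>e\<close> would force a triangle at
        \<open>d\<close>. Two of \<open>x\<close>, \<open>p\<close>, \<open>e\<close> would then be
        adjacent, so \<open>e\<close> would be one of \<open>y, z, w, q\<close>, none of which is
        adjacent to \<open>d\<close>.\<close>
      have "N d = {x, p}"
      proof (rule ccontr)
        assume "N d \<noteq> {x, p}"
        then have lt: "{x, p} \<subset> N d" using xpd by auto
        then have "card {x, p} < card (N d)" using A(3)[OF dV] by (rule psubset_card_mono[rotated])
        then have c3: "card (N d) = 3" using A(5)[OF dV] dist by simp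
        obtain a b where ab: "a \<in> N d" "b \<in> N d" "a \<in> N b" using A(6)[OF dV c3] by blast
        obtain e where e: "e \<in> N d" "e \<noteq> x" "e \<noteq> p" using lt by auto
        have "N d = {x, p, e}"
          using card_seteq[OF A(3)[OF dV], of "{x, p, e}"] xpd e c3 dist by auto
        moreover have "b \<in> N a" using A(8)[OF A(9)[OF dV ab(2)] ab(3)] .
        moreover have "a \<noteq> b" using A(4)[OF A(9)[OF dV ab(2)]] ab(3) by auto
        ultimately have "e \<in> N x \<or> e \<in> N p \<or> p \<in> N x \<or> x \<in> N p" using ab by auto
        moreover have "e \<noteq> d" using e A(4)[OF dV] by auto
        ultimately have "e \<in> {y, z, w, q}" using Nx Np XP d dist by auto
        moreover have "d \<in> N e" using A(8)[OF dV e(1)] .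
        ultimately show False using d Ny Nz Nw Nq by auto
      qed
      note Nd = this
      define C where "C = {x, y, z, w, p, q, d}"
      define g where "g = (\<lambda>_. 0 :: nat)(x := 1, y := 3, p := 2, q := 1)"
      have g: "g x = 1" "g y = 3" "g z = 0" "g w = 0" "g p = 2" "g q = 1" "g d = 0"
        using dist d by (auto simp: g_def)
      have Nx': "N x = {y, z, d}" and Np': "N p = {w, q, d}" using Nx Np XP by auto
      have sub: "\<forall>s\<in>C. N s \<subseteq> C" by (simp add: C_def Nx' Np' Ny Nz Nw Nq Nd)
      have okg: "\<forall>s\<in>C. valid_at N g s" by (simp add: C_def valid_at_def Nx' Np' Ny Nz Nw Nq Nd g)
      have CV: "C \<subseteq> V" "y \<in> C" using V VV dV by (auto simp: C_def)
      show ?thesis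
        using colorable_component[OF adm CV(1), of g] sub okg col[OF CV(2)] by blast
    qed
  next
    case False
    define W where "W = V - {y, z, w, p, q}"
    \<comment> \<open>Edges that ended in \<open>p\<close> end in \<open>x\<close> from now
      on.\<close>
    define r where "r = (\<lambda>s. if s = p then x else s)"
    define M where "M = (\<lambda>t. if t = x then X \<union> P else r ` N t)"
    have xW: "x \<in> W" using VV dist by (auto simp: W_def)
    have xP: "x \<notin> P" using False A(8)[OF VV(3), of x] Np Nx dist by auto
    have xX: "x \<notin> X" using Xn by auto
    have Wn: "y \<notin> N t" "z \<notin> N t" "w \<notin> N t" "q \<notin> N t" if "t \<in> W" "t \<noteq> x" for t
      using A(8)[of t] that Ny Nz Nw Nq unfolding W_def by blast+
    have XW: "X \<subseteq> W" "P \<subseteq> W" using Xn Pn XV PV False by (auto simp: W_def)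
    have WV: "t \<in> V" if "t \<in> W" for t using that by (auto simp: W_def)
    have Msub: "M t \<subseteq> W" if "t \<in> W" for t
      using that XW Wn[OF that] A(2)[OF WV[OF that]] xW by (auto simp: M_def r_def W_def)
    have cM: "card (M t) \<le> card (N t)" if "t \<in> W" "t \<noteq> x" for t
      using that A(3)[OF WV[OF that(1)]] by (simp add: M_def card_image_le)
    have "X \<union> P \<subseteq> {x', p'}" using Nx(3) Np(3) by blast
    then have "card (X \<union> P) \<le> card {x', p'}" by (intro card_mono) auto
    also have "\<dots> \<le> 2" by (simp add: card_insert_if)
    \<comment> \<open>Degree at most 2 exempts the new vertex from the triangle condition and lets
      it serve as the low-degree neighbour of others.\<close>
    finally have cx: "card (M x) \<le> 2" by (simp add: M_def)
    have pM: "r s \<in> M t" if "s \<in> N t" "t \<noteq> x" for s t using that by (auto simp: M_def)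
    have xpN: "x \<in> N t \<longleftrightarrow> t \<in> X" "p \<in> N t \<longleftrightarrow> t \<in> P" if "t \<in> W" for t
    proof -
      have "x \<in> N t \<longleftrightarrow> t \<in> N x" "p \<in> N t \<longleftrightarrow> t \<in> N p" using A(8) WV[OF that] VV by blast+
      then show "x \<in> N t \<longleftrightarrow> t \<in> X" "p \<in> N t \<longleftrightarrow> t \<in> P" using that Nx Np by (auto simp: W_def)
    qed
    have symM: "w' \<in> M u" if uw: "u \<in> W" "w' \<in> W" "u \<in> M w'" for u w'
    proof -
      consider "w' = x" | "w' \<noteq> x" "u = x" | "w' \<noteq> x" "u \<noteq> x" by blast
      then show ?thesis
      proof cases
        case 1
        then have "u \<in> X \<union> P" using uw by (simp add: M_def)
        then have "u \<noteq> x" "x \<in> N u \<or> p \<in> N u" using xX xP xpN[OF uw(1)] by auto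
        then show ?thesis using pM[of x u] pM[of p u] 1 dist by (auto simp: r_def)
      next
        case 2
        then have "x \<in> N w' \<or> p \<in> N w'" using uw by (auto simp: M_def r_def split: if_splits)
        then show ?thesis using 2 xpN[OF uw(2)] by (auto simp: M_def)
      next
        case 3
        then have "u \<in> N w'" "u \<noteq> p" using uw by (auto simp: M_def r_def W_def split: if_splits)
        then have "w' \<in> N u" using A(8) WV uw by blast
        moreover have "w' \<noteq> p" using uw by (auto simp: W_def)
        ultimately show ?thesis using pM[of w' u] 3 by (auto simp: r_def)
      qed
    qed
    have "admissible W M"
      unfolding admissible_def
    proof (intro conjI ballI impI)
      show "finite W" using A(1) by (simp add: W_def)
      fix t assume t: "t \<in> W"
      show "M t \<subseteq> W" by (rule Msub[OF t])
      show "t \<notin> M t"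
        using xX xP A(4)[OF WV[OF t]] by (auto simp: M_def r_def split: if_splits)
      show "card (M t) \<le> 3"
        using cx cM[OF t] A(5)[OF WV[OF t]] by (cases "t = x") auto
      {
        assume c: "card (M t) = 3"
        then have tx: "t \<noteq> x" using cx by auto
        have c3: "card (N t) = 3" using cM[OF t tx] A(5)[OF WV[OF t]] c by simp
        obtain a b where ab: "a \<in> N t" "b \<in> N t" "a \<in> N b" using A(6)[OF WV[OF t] c3] by blast
        have mem: "a \<in> V" "b \<in> V" "b \<in> N a" "t \<in> N a" "t \<in> N b"
          using A(8,9) WV[OF t] ab by blast+
        \<comment> \<open>A triangle at \<open>t\<close> that contained \<open>x\<close> or
          \<open>p\<close> would give that vertex two outer neighbours. So the triangle avoids both
          and survives the replacement.\<close>
        have ne: "a \<noteq> x \<and> a \<noteq> p \<and> b \<noteq> x \<and> b \<noteq> p"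
        proof -
          have *: "s \<noteq> x \<and> s \<noteq> p" if "s \<in> N t" "s' \<in> N t" "s' \<in> N s" "t \<in> N s" "s' \<noteq> t" for s s'
          proof -
            have "t \<in> X \<Longrightarrow> s' \<in> X \<Longrightarrow> s' = t" "t \<in> P \<Longrightarrow> s' \<in> P \<Longrightarrow> s' = t"
              using Nx(3) Np(3) by auto
            then show ?thesis using that Nx(1) Np(1) Wn[OF t tx] t tx unfolding W_def by auto
          qed
          show ?thesis
            using *[of a b] *[of b a] ab mem A(4)[OF WV[OF t]] by blast
        qed
        then have "r a = a" "r b = b" by (auto simp: r_def)
        then have "a \<in> M t" "b \<in> M t" "a \<in> M b" using pM ab tx ne by metis+
        then show "\<exists>u\<in>M t. \<exists>w\<in>M t. u \<in> M w" by blast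
        obtain u where u: "u \<in> N t" "card (N u) \<le> 2" using A(7)[OF WV[OF t] c3] by blast
        have ru: "r u \<in> M t" using pM u tx by blast
        have "card (M (r u)) \<le> 2"
        proof (cases "r u = x")
          case False
          then have "u \<noteq> p" "u \<noteq> x" by (auto simp: r_def split: if_splits)
          then show ?thesis using cM[of u] Msub[OF t] ru u by (auto simp: r_def)
        qed (use cx in simp)
        then show "\<exists>u\<in>M t. card (M u) \<le> 2" using ru by blast
      }
    next
      fix u w' assume "u \<in> W" "w' \<in> W" "u \<in> M w'"
      then show "w' \<in> M u" by (rule symM)
    qed
    moreover have "card W < card V"
      unfolding W_def using V A(1) by (intro psubset_card_mono) auto
    ultimately have "colorable W M" by (rule smaller[rotated])
    then obtain f where f: "\<And>s. s \<in> W \<Longrightarrow> valid_at M f s" unfolding colorable_def by blast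
    define c where "c = f x"
    have c: "c < 4" "\<And>s. s \<in> X \<union> P \<Longrightarrow> f s < 4 \<and> f s \<noteq> c"
      "\<And>s s'. s \<in> X \<union> P \<Longrightarrow> s' \<in> X \<union> P \<Longrightarrow> s \<noteq> s' \<Longrightarrow> f s = f s' \<Longrightarrow> f s = 0"
      using f[OF xW] f XW unfolding c_def valid_at_def by (auto simp: M_def)
    \<comment> \<open>For a missing outer neighbour a color is invented, so that
      \<open>triangle_pair_colors\<close> applies uniformly.\<close>
    have "\<exists>a b. a < 4 \<and> b < 4 \<and> a \<noteq> c \<and> b \<noteq> c \<and> (a = b \<longrightarrow> a = 0) \<and> (\<forall>s\<in>X. f s = a) \<and> (\<forall>s\<in>P. f s = b)"
    proof -
      have pick: "\<exists>k<4. k \<noteq> c \<and> (k = l \<longrightarrow> k = 0)" for l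
        using fresh_color[of l c] by metis
      have "X = {} \<or> X = {x'}" "P = {} \<or> P = {p'}" using Nx(3) Np(3) by auto
      then consider "X = {}" "P = {}" | "X = {}" "P = {p'}" | "X = {x'}" "P = {}"
        | "X = {x'}" "P = {p'}" by blast
      then show ?thesis
      proof cases
        case 1
        obtain l where "l < 4" "l \<noteq> c" using pick by blast
        then show ?thesis using 1 pick[of l] by auto
      next
        case 2
        then show ?thesis using pick[of "f p'"] c(2)[of p'] by auto
      next
        case 3
        then show ?thesis using pick[of "f x'"] c(2)[of x'] by (metis UnI1 empty_iff singletonD singletonI)
      next
        case 4
        then have "x' \<noteq> p'" using False by auto
        then show ?thesis using 4 c(2)[of x'] c(2)[of p'] c(3)[of x' p']
          by (intro exI[of _ "f x'"] exI[of _ "f p'"]) auto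
      qed
    qed
    then obtain a b where ab: "a < 4" "b < 4" "a \<noteq> c" "b \<noteq> c" "a = b \<longrightarrow> a = 0"
      "\<And>s. s \<in> X \<Longrightarrow> f s = a" "\<And>s. s \<in> P \<Longrightarrow> f s = b" by blast
    obtain fx fy fz fw fp fq where g: "fx < 4" "fy < 4" "fz < 4" "fw < 4" "fp < 4" "fq < 4"
      "fx = c \<or> fx = 0" "fp = c \<or> fp = 0" "fx \<noteq> a" "fp \<noteq> b"
      "distinct [fx, fy, fz]" "distinct [fw, fp, fq]"
      "fy = a \<longrightarrow> a = 0" "fz = a \<longrightarrow> a = 0" "fw = b \<longrightarrow> b = 0" "fq = b \<longrightarrow> b = 0"
      "fy \<noteq> fw" "fx = fw \<longrightarrow> fx = 0" "fz = fw \<longrightarrow> fz = 0" "fp = fy \<longrightarrow> fp = 0" "fq = fy \<longrightarrow> fq = 0"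
      by (rule triangle_pair_colors[OF ab(1,2) c(1) ab(3,4,5)])
    define h where "h = f(x := fx, y := fy, z := fz, w := fw, p := fp, q := fq)"
    have h: "h x = fx" "h y = fy" "h z = fz" "h w = fw" "h p = fp" "h q = fq"
      "\<And>s. s \<in> W \<Longrightarrow> s \<noteq> x \<Longrightarrow> h s = f s"
      using dist by (auto simp: h_def W_def)
    have hX: "\<And>s. s \<in> X \<Longrightarrow> h s = a" "\<And>s. s \<in> P \<Longrightarrow> h s = b"
      using h(7) ab(6,7) XW xX xP by (metis subsetD)+
    have "valid_at N h s" if s: "s \<in> V" for s
    proof -
      consider "s = x" | "s = y" | "s = z" | "s = w" | "s = p" | "s = q" | "s \<in> W" "s \<noteq> x"
        using s by (auto simp: W_def)
      then show ?thesis
      proof cases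
        case 7
        \<comment> \<open>Since \<open>X\<close> and \<open>P\<close> are disjoint, \<open>s\<close>
          is not adjacent to both \<open>x\<close> and \<open>p\<close>, which makes
          \<open>r\<close> injective on \<open>N s\<close>. If \<open>x\<close> or \<open>p\<close>
          does not keep the color \<open>c\<close>, it gets 0, which differs from the color of its
          outer neighbour \<open>s\<close>.\<close>
        show ?thesis
        proof (rule valid_at_transfer[OF f[OF 7(1)], where r = r])
          show "inj_on r (N s)"
            using False xpN[OF 7(1)] by (auto simp: inj_on_def r_def)
          show "r ` N s \<subseteq> M s" using 7 by (simp add: M_def)
          show "h s = f s" by (rule h(7)[OF 7])
          fix t assume t: "t \<in> N s"
          consider "t = x" | "t = p" | "t \<noteq> x" "t \<noteq> p" by blast
          then show "h t = f (r t) \<or> h t = 0 \<and> f s \<noteq> 0"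
          proof cases
            case 1
            then have "s \<in> X" using xpN(1)[OF 7(1)] t by simp
            then have "f s = a" "r t = x" using ab(6) 1 by (auto simp: r_def)
            then show ?thesis using 1 g(7,9) h(1) c_def by metis
          next
            case 2
            then have "s \<in> P" using xpN(2)[OF 7(1)] t by simp
            then have "f s = b" "r t = x" using ab(7) 2 by (auto simp: r_def)
            then show ?thesis using 2 g(8,10) h(5) c_def by metis
          next
            case 3
            then have "t \<in> W" using A(9)[OF s t] Wn[OF 7] t by (auto simp: W_def)
            then show ?thesis using 3 h(7) by (auto simp: r_def)
          qed
        qed
      next
        case 1
        have "(N x = {y, z}) \<or> (N x = {y, z, x'} \<and> h x' = a)" using Nx hX by auto
        then show ?thesis
          unfolding valid_at_def 1 h(1) using g(1,9,11,13,14) h(2,3) by (elim disjE conjE) auto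
      next
        case 2
        show ?thesis unfolding valid_at_def 2 Ny using g(2,11,17,18,19) h(1-4) by auto
      next
        case 3
        show ?thesis unfolding valid_at_def 3 Nz using g(3,11) h(1-3) by auto
      next
        case 4
        show ?thesis unfolding valid_at_def 4 Nw using g(4,12,17,20,21) h(2,4,5,6) by auto
      next
        case 5
        have "(N p = {w, q}) \<or> (N p = {w, q, p'} \<and> h p' = b)" using Np hX by auto
        then show ?thesis
          unfolding valid_at_def 5 h(5) using g(5,10,12,15,16) h(4,6) by (elim disjE conjE) auto
      next
        case 6
        show ?thesis unfolding valid_at_def 6 Nq using g(6,12) h(4-6) by auto
      qed
    qed
    then show ?thesis unfolding colorable_def by blast
  qed
qed

section \<open>Unions of two matchings\<close>

text \<open>A matching is a symmetric, single-valued, irreflexive relation. Both ends of an edge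
  determine the same set \<open>{u, v}\<close>, hence the same chosen representative; the color says
  whether a vertex is that representative.\<close>

lemma matching_2_colorable:
  assumes "sym M" "single_valued M" "irrefl M"
  shows "\<exists>f :: 'a \<Rightarrow> bool. \<forall>(u, v)\<in>M. f u \<noteq> f v"
proof -
  define rep where "rep = (\<lambda>u. SOME r. r \<in> {u} \<union> M `` {u})"
  have "(u = rep u) \<noteq> (v = rep v)" if uv: "(u, v) \<in> M" for u v
  proof -
    have "{u} \<union> M `` {u} = {u, v}" "{v} \<union> M `` {v} = {u, v}"
      using uv assms by (auto dest: symD single_valuedD)
    then have eq: "rep u = (SOME r. r \<in> {u, v})" "rep v = (SOME r. r \<in> {u, v})"
      unfolding rep_def by (simp_all only:)
    define e where "e = (SOME r. r \<in> {u, v})"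
    have "e \<in> {u, v}" unfolding e_def by (rule someI[of _ u]) simp
    moreover have "u \<noteq> v" using uv assms(3) by (auto simp: irrefl_def)
    ultimately show ?thesis unfolding eq e_def[symmetric] by auto
  qed
  then show ?thesis by (intro exI[of _ "\<lambda>u. u = rep u"]) auto
qed

text \<open>The union consists of paths and even cycles. Removing an edge of \<open>M1\<close> with
  both ends and splicing their partners in \<open>M2\<close> together shortens a path or cycle by
  two vertices, which preserves parity.\<close>

lemma two_matchings_2_colorable:
  assumes "finite M1" "sym M1" "single_valued M1" "irrefl M1"
    and "sym M2" "single_valued M2" "irrefl M2"
  shows "\<exists>f :: 'a \<Rightarrow> bool. \<forall>(u, v)\<in>M1 \<union> M2. f u \<noteq> f v"
  using assms
proof (induction "card M1" arbitrary: M1 M2 rule: less_induct)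
  case less
  note S1 = symD[OF less.prems(2)] and F1 = single_valuedD[OF less.prems(3)]
  note S2 = symD[OF less.prems(5)] and F2 = single_valuedD[OF less.prems(6)]
  show ?case
  proof (cases "M1 = {}")
    case True
    then show ?thesis using matching_2_colorable[OF less.prems(5-7)] by simp
  next
    case False
    then obtain s s' where ss: "(s, s') \<in> M1" by (metis equals0I surj_pair)
    have ne: "s \<noteq> s'" using ss less.prems(4) by (auto simp: irrefl_def)
    have ss': "(s', s) \<in> M1" using S1 ss by blast
    define M1' where "M1' = M1 - {(s, s'), (s', s)}"
    \<comment> \<open>after deleting \<open>s\<close> and \<open>s'\<close>, their partners in \<open>M2\<close> must get different colors\<close>
    define M2' where "M2' = {(a, b). a \<notin> {s, s'} \<and> b \<notin> {s, s'} \<and>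
      ((a, b) \<in> M2 \<or> (a, s) \<in> M2 \<and> (s', b) \<in> M2 \<or> (a, s') \<in> M2 \<and> (s, b) \<in> M2)}"
    have "card M1' < card M1"
      unfolding M1'_def using ss less.prems(1) by (intro psubset_card_mono) auto
    moreover have "finite M1'" "sym M1'" "single_valued M1'" "irrefl M1'"
      using less.prems(1-4) unfolding M1'_def sym_def single_valued_def irrefl_def by auto
    moreover have "sym M2'"
      unfolding M2'_def using S2 by (auto intro!: symI)
    moreover have "single_valued M2'"
    proof (rule single_valuedI)
      fix x y z assume "(x, y) \<in> M2'" "(x, z) \<in> M2'"
      then have "x \<noteq> s" "x \<noteq> s'" "y \<noteq> s" "y \<noteq> s'" "z \<noteq> s" "z \<noteq> s'"
        "(x, y) \<in> M2 \<or> (x, s) \<in> M2 \<and> (s', y) \<in> M2 \<or> (x, s') \<in> M2 \<and> (s, y) \<in> M2"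
        "(x, z) \<in> M2 \<or> (x, s) \<in> M2 \<and> (s', z) \<in> M2 \<or> (x, s') \<in> M2 \<and> (s, z) \<in> M2"
        unfolding M2'_def by auto
      then show "y = z" using ne F2 by metis
    qed
    moreover have "irrefl M2'"
    proof (rule irreflI)
      fix x show "(x, x) \<notin> M2'"
      proof
        assume "(x, x) \<in> M2'"
        then have "(x, x) \<in> M2 \<or> (x, s) \<in> M2 \<and> (s', x) \<in> M2 \<or> (x, s') \<in> M2 \<and> (s, x) \<in> M2"
          unfolding M2'_def by auto
        then have "(x, s) \<in> M2 \<and> (x, s') \<in> M2"
          using S2 less.prems(7) by (auto simp: irrefl_def)
        then show False using ne F2 by metis
      qed
    qed
    ultimately obtain f :: "'a \<Rightarrow> bool" where f: "\<forall>(u, v)\<in>M1' \<union> M2'. f u \<noteq> f v"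
      using less.hyps by blast
    \<comment> \<open>The colors of \<open>s\<close> and \<open>s'\<close> will be \<open>c\<close>
      and its negation. The partner of \<open>s\<close> must differ from \<open>c\<close> and the
      partner of \<open>s'\<close> must equal \<open>c\<close>; the spliced edge between the
      partners makes these demands compatible. The exceptions cover the case that
      \<open>s s'\<close> is also an edge of \<open>M2\<close>.\<close>
    have "\<exists>c. (\<forall>a. (a, s) \<in> M2 \<and> a \<noteq> s' \<longrightarrow> f a \<noteq> c) \<and> (\<forall>a. (a, s') \<in> M2 \<and> a \<noteq> s \<longrightarrow> f a = c)"
    proof (cases "\<exists>a. (a, s) \<in> M2 \<and> a \<noteq> s'")
      case True
      then obtain a where a: "(a, s) \<in> M2" "a \<noteq> s'" by blast
      have as: "a \<noteq> s" using a less.prems(7) by (auto simp: irrefl_def)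
      have "b = a" if "(b, s) \<in> M2" for b using F2 S2 that a by metis
      moreover have "f b = (\<not> f a)" if b: "(b, s') \<in> M2" "b \<noteq> s" for b
      proof -
        have "b \<noteq> s'" using b less.prems(7) by (auto simp: irrefl_def)
        then have "(a, b) \<in> M2'" unfolding M2'_def using a b as S2 by auto
        then show ?thesis using f by blast
      qed
      ultimately show ?thesis by (intro exI[of _ "\<not> f a"]) metis
    next
      case False
      show ?thesis
      proof (cases "\<exists>b. (b, s') \<in> M2")
        case True
        then obtain b where b: "(b, s') \<in> M2" by blast
        have "c = b" if "(c, s') \<in> M2" for c using F2 S2 that b by metis
        then show ?thesis using False by (intro exI[of _ "f b"]) metis
      qed (use False in blast)
    qed
    then obtain c where c: "\<And>a. (a, s) \<in> M2 \<Longrightarrow> a \<noteq> s' \<Longrightarrow> f a \<noteq> c"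
      "\<And>a. (a, s') \<in> M2 \<Longrightarrow> a \<noteq> s \<Longrightarrow> f a = c" by blast
    define g where "g = f(s := c, s' := \<not> c)"
    have g: "g s = c" "g s' = (\<not> c)" "\<And>a. a \<noteq> s \<Longrightarrow> a \<noteq> s' \<Longrightarrow> g a = f a"
      using ne by (auto simp: g_def)
    have "g u \<noteq> g v" if uv: "(u, v) \<in> M1 \<union> M2" for u v
    proof -
      have uv': "(u, v) \<in> M1 \<Longrightarrow> (v, u) \<in> M1" "(u, v) \<in> M2 \<Longrightarrow> (v, u) \<in> M2" using S1 S2 by blast+
      have "u \<noteq> v" using uv less.prems(4,7) by (auto simp: irrefl_def)
      consider "u \<in> {s, s'}" "v \<in> {s, s'}" | "u \<in> {s, s'}" "v \<notin> {s, s'}"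
        | "u \<notin> {s, s'}" "v \<in> {s, s'}" | "u \<notin> {s, s'}" "v \<notin> {s, s'}" by blast
      then show ?thesis
      proof cases
        case 1
        then show ?thesis using g \<open>u \<noteq> v\<close> by auto
      next
        case 2
        then have "(v, u) \<in> M2" using uv uv' F1 ss ss' by blast
        then show ?thesis using 2 c[of v] g by auto
      next
        case 3
        then have "(u, v) \<in> M2" using uv uv' F1 ss ss' by blast
        then show ?thesis using 3 c[of u] g by auto
      next
        case 4
        then have "(u, v) \<in> M1' \<union> M2'" using uv by (auto simp: M1'_def M2'_def)
        then show ?thesis using f g 4 by auto
      qed
    qed
    then show ?thesis by blast
  qed
qed

section \<open>Irreducible graphs\<close>

text \<open>The assumptions after \<open>adm\<close> say that no reduction applies. In
  \<open>no_path\<close> the conclusion leaves only the component that is a triangle of three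
  vertices of degree 2; \<open>no_diamond\<close> says that an edge lies in at most one
  triangle.\<close>

locale reduced =
  fixes V :: "'a set" and N :: "'a \<Rightarrow> 'a set"
  assumes adm: "admissible V N"
    and min_degree: "t \<in> V \<Longrightarrow> 2 \<le> card (N t)"
    and no_path: "v \<in> V \<Longrightarrow> N v = {u, w} \<Longrightarrow> u \<noteq> w \<Longrightarrow> card (N u) = 2 \<Longrightarrow> card (N w) = 2 \<Longrightarrow> u \<in> N w"
    and no_diamond: "u \<in> V \<Longrightarrow> v \<in> N u \<Longrightarrow> a \<in> N u \<inter> N v \<Longrightarrow> b \<in> N u \<inter> N v \<Longrightarrow> a = b"
    and no_triangle_pair: "u \<in> V \<Longrightarrow> v \<in> N u \<Longrightarrow> card (N u) = 3 \<Longrightarrow> card (N v) = 3 \<Longrightarrow> N u \<inter> N v \<noteq> {}"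
begin

lemmas A = admissibleD[OF adm]

text \<open>This is the vertex set of the unique triangle through \<open>t\<close>, and
  \<open>{t}\<close> if there is none.\<close>

definition tri :: "'a \<Rightarrow> 'a set" where
  "tri t = insert t {u \<in> N t. N u \<inter> N t \<noteq> {}}"

text \<open>If a third neighbour \<open>e\<close> of \<open>t\<close> also lay in a triangle with
  \<open>t\<close>, that triangle would contain \<open>a\<close> or \<open>b\<close>. So
  \<open>t a\<close> or \<open>t b\<close> would be an edge of two triangles, that is, of a
  diamond.\<close>

lemma tri_eq:
  assumes "t \<in> V" "a \<in> N t" "b \<in> N t" "a \<in> N b"
  shows "tri t = {t, a, b}"
proof -
  have V: "a \<in> V" "b \<in> V" using A(9) assms by blast+
  have ba: "b \<in> N a" using A(8)[OF V(2) assms(4)] .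
  have ab: "a \<noteq> b" using A(4)[OF V(2)] assms(4) by auto
  have "e \<in> {a, b}" if e: "e \<in> N t" "s \<in> N e" "s \<in> N t" for e s
  proof (rule ccontr)
    assume ne: "e \<notin> {a, b}"
    have eq: "{a, b, e} = N t"
      using card_seteq[OF A(3)[OF assms(1)], of "{a, b, e}"] A(5)[OF assms(1)] ne ab e assms by auto
    have eV: "e \<in> V" using A(9)[OF assms(1) e(1)] .
    have "e \<in> N s" using A(8)[OF eV e(2)] .
    moreover have "s \<noteq> e" using A(4)[OF eV] e(2) by auto
    then have "s = a \<or> s = b" using eq e(3) by auto
    ultimately show False
      using no_diamond[OF assms(1), of s b e] no_diamond[OF assms(1), of s a e] e ne assms ba by auto
  qed
  then show ?thesis unfolding tri_def using assms ba by blast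
qed

lemma deg_cases:
  assumes "t \<in> V"
  shows "card (N t) = 2 \<or> card (N t) = 3"
  using min_degree[OF assms] A(5)[OF assms] by arith

text \<open>At a vertex of degree 3 the third neighbour \<open>d\<close> shares no triangle with it,
  so \<open>no_triangle_pair\<close> gives \<open>d\<close> degree 2. A triangle at \<open>d\<close>
  would use both of its neighbours, hence \<open>t\<close>, so \<open>d\<close> lies in
  none.\<close>

lemma vertex_cases:
  assumes t: "t \<in> V"
  obtains (deg3) a b d where "N t = {a, b, d}" "card (N t) = 3" "a \<noteq> b" "a \<in> N b" "tri t = {t, a, b}"
      "card (N d) = 2" "tri d = {d}"
    | (deg2) a b where "N t = {a, b}" "card (N t) = 2" "a \<noteq> b" "a \<in> N b" "tri t = {t, a, b}"
    | (leg) a b where "N t = {a, b}" "card (N t) = 2" "a \<noteq> b" "a \<notin> N b" "tri t = {t}"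
proof -
  consider "card (N t) = 3" | "card (N t) = 2" using deg_cases[OF t] by blast
  then show ?thesis
  proof cases
    case 1
    obtain a b where ab: "a \<in> N t" "b \<in> N t" "a \<in> N b" using A(6)[OF t 1] by blast
    have V: "a \<in> V" "b \<in> V" using A(9) t ab by blast+
    have ne: "a \<noteq> b" using A(4)[OF V(2)] ab by auto
    have tt: "tri t = {t, a, b}" by (rule tri_eq[OF t ab])
    have "\<not> N t \<subseteq> {a, b}" using card_mono[of "{a, b}" "N t"] 1 ne by auto
    then obtain d where d: "d \<in> N t" "d \<noteq> a" "d \<noteq> b" by blast
    have Nt: "N t = {a, b, d}"
      using card_seteq[OF A(3)[OF t], of "{a, b, d}"] 1 ne ab d by auto
    have dV: "d \<in> V" using A(9)[OF t d(1)] .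
    have dt: "d \<noteq> t" using A(4)[OF t] d by auto
    have "d \<notin> tri t" using tt d dt by auto
    then have disj: "N d \<inter> N t = {}" using d by (auto simp: tri_def)
    then have c2: "card (N d) = 2"
      using no_triangle_pair[OF t d(1) 1] deg_cases[OF dV] by auto
    have td: "t \<in> N d" using A(8)[OF t d(1)] .
    have "N u \<inter> N d = {}" if u: "u \<in> N d" for u
    proof (cases "u = t")
      case True
      then show ?thesis using disj by auto
    next
      case False
      then have "N d = {t, u}"
        using card_seteq[OF A(3)[OF dV], of "{t, u}"] c2 td u by auto
      moreover have "u \<notin> N u" using A(4)[OF A(9)[OF dV u]] .
      moreover have "t \<notin> N u" using A(8)[OF A(9)[OF dV u], of t] disj u by auto
      ultimately show ?thesis by auto
    qed
    then have "tri d = {d}" by (auto simp: tri_def)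
    then show ?thesis using deg3[OF Nt 1 ne ab(3) tt c2] by blast
  next
    case 2
    then obtain a b where Nt: "N t = {a, b}" "a \<noteq> b" by (auto simp: card_2_iff)
    show ?thesis
    proof (cases "a \<in> N b")
      case True
      have "tri t = {t, a, b}" by (rule tri_eq) (use t Nt True in auto)
      then show ?thesis using deg2[OF Nt(1) 2 Nt(2) True] by blast
    next
      case False
      have V: "a \<in> V" "b \<in> V" using A(9)[OF t] Nt by auto
      have "b \<notin> N a" using A(8)[OF V(1)] False by blast
      then have "tri t = {t}" using Nt False A(4)[OF V(1)] A(4)[OF V(2)] by (auto simp: tri_def)
      then show ?thesis using leg[OF Nt(1) 2 Nt(2) False] by blast
    qed
  qed
qed

text \<open>The sets \<open>tri t\<close> partition \<open>V\<close>: \<open>tri_eq\<close> gives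
  the same set from each corner of a triangle.\<close>

lemma tri_mem: "t \<in> V \<Longrightarrow> u \<in> tri t \<Longrightarrow> u \<in> V \<and> tri u = tri t"
proof -
  assume t: "t \<in> V" and u: "u \<in> tri t"
  have uV: "u \<in> V" using A(9)[OF t] t u by (auto simp: tri_def)
  have *: "tri a = {t, a, b} \<and> tri b = {t, a, b}" if ab: "a \<in> N t" "b \<in> N t" "a \<in> N b" for a b
  proof -
    have V: "a \<in> V" "b \<in> V" using A(9) t ab by blast+
    have "t \<in> N a" "t \<in> N b" "b \<in> N a" using A(8) t V ab by blast+
    moreover have "b \<in> N t" "a \<in> N t" using ab by auto
    ultimately show ?thesis using tri_eq[OF V(1), of t b] tri_eq[OF V(2), of t a] ab by auto
  qed
  from t show "u \<in> V \<and> tri u = tri t"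
  proof (cases rule: vertex_cases)
    case (deg3 a b d)
    then show ?thesis using *[of a b] u uV by auto
  next
    case (deg2 a b)
    then show ?thesis using *[of a b] u uV by auto
  next
    case (leg a b)
    then show ?thesis using u uV by auto
  qed
qed

lemma card_tri:
  assumes "t \<in> V"
  shows "tri t = {t} \<or> card (tri t) = 3"
  using assms
proof (cases rule: vertex_cases)
  case (deg3 a b d)
  then show ?thesis using A(4)[OF assms] by (auto simp: card_insert_if)
next
  case (deg2 a b)
  then show ?thesis using A(4)[OF assms] by (auto simp: card_insert_if)
qed simp

lemma self_in_tri: "t \<in> tri t" by (simp add: tri_def)

section \<open>Legs between triangles\<close>

text \<open>Two of the three neighbours belong to the triangle at \<open>t\<close>.\<close>

lemma leg_unique:
  assumes "t \<in> V" "card (N t) = 3" "d \<in> N t" "tri d = {d}" "e \<in> N t" "tri e = {e}"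
  shows "d = e"
  using assms(1)
proof (cases rule: vertex_cases)
  case (deg3 a b c)
  have "tri a = tri t" "tri b = tri t" using tri_mem[OF assms(1)] deg3 by auto
  then have "tri a \<noteq> {a}" "tri b \<noteq> {b}" using deg3 by auto
  then show ?thesis using assms deg3 by auto
qed (use assms in auto)

lemma deg3_tri: "t \<in> V \<Longrightarrow> card (N t) = 3 \<Longrightarrow> tri t \<noteq> {t}"
  by (cases rule: vertex_cases[of t]) auto

text \<open>A triangle at a vertex \<open>b\<close> of degree 2 contains both neighbours of
  \<open>b\<close>, hence \<open>t\<close>.\<close>

lemma leg_nbr:
  assumes "t \<in> V" "tri t = {t}" "b \<in> N t" "card (N b) = 2"
  shows "tri b = {b}"
proof -
  have b: "b \<in> V" using A(9) assms by blast
  have tb: "t \<in> N b" using A(8) assms by blast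
  have False if "tri b = {b, x, y}" "N b = {x, y}" for x y
  proof -
    have "t \<in> tri b" using that tb by auto
    then have "tri b = {t}" using tri_mem[OF b] assms(2) by auto
    then have "b = t" using self_in_tri[of b] by auto
    then show False using A(4)[OF b] tb by auto
  qed
  note no_tri = this
  show ?thesis
    using b
  proof (cases rule: vertex_cases)
    case (deg2 x y)
    then show ?thesis using no_tri[of x y] by blast
  qed (use assms in auto)
qed

text \<open>Dropping one vertex \<open>h T\<close> from each triangle \<open>T\<close> selected by
  \<open>Q\<close> leaves disjoint pairs. Such matchings are needed twice, with different choices of
  the dropped vertex.\<close>

lemma matching_in_triangles:
  assumes "\<And>t. t \<in> V \<Longrightarrow> tri t \<noteq> {t} \<Longrightarrow> Q (tri t) \<Longrightarrow> h (tri t) \<in> tri t"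
  defines "M \<equiv> {(u, v). u \<in> V \<and> v \<in> tri u \<and> u \<noteq> v \<and> u \<noteq> h (tri u) \<and> v \<noteq> h (tri u) \<and> Q (tri u)}"
  shows "finite M" "sym M" "single_valued M" "irrefl M"
proof -
  have M: "(u, v) \<in> M \<longleftrightarrow>
      u \<in> V \<and> v \<in> tri u \<and> u \<noteq> v \<and> u \<noteq> h (tri u) \<and> v \<noteq> h (tri u) \<and> Q (tri u)" for u v
    by (simp add: M_def)
  have mem: "u \<in> V" "v \<in> V" "tri v = tri u" if "(u, v) \<in> M" for u v
  proof -
    have uv: "u \<in> V" "v \<in> tri u" using that by (simp_all add: M)
    then show "u \<in> V" "v \<in> V" "tri v = tri u" using tri_mem[OF uv] by simp_all
  qed
  have "M \<subseteq> V \<times> V"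
  proof (rule subrelI)
    fix u v assume "(u, v) \<in> M"
    then show "(u, v) \<in> V \<times> V" using mem by simp
  qed
  then show "finite M" by (rule finite_subset) (use A(1) in simp)
  show "sym M"
  proof (rule symI)
    fix u v assume uv: "(u, v) \<in> M"
    then have "v \<in> V" "tri v = tri u" using mem by simp_all
    moreover have "u \<noteq> v" using uv by (simp add: M)
    then have "v \<noteq> u" by (rule not_sym)
    ultimately show "(v, u) \<in> M" using uv self_in_tri[of u] by (simp add: M)
  qed
  show "irrefl M" by (rule irreflI) (simp add: M)
  show "single_valued M"
  proof (rule single_valuedI, rule ccontr)
    fix u v w assume uv: "(u, v) \<in> M" "(u, w) \<in> M" and ne: "v \<noteq> w"
    then have u: "u \<in> V" "v \<in> tri u" "w \<in> tri u" "u \<noteq> v" "u \<noteq> w" "Q (tri u)"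
      and h: "u \<noteq> h (tri u)" "v \<noteq> h (tri u)" "w \<noteq> h (tri u)"
      unfolding M by simp_all
    then have nt: "tri u \<noteq> {u}" by auto
    then have c: "card (tri u) = 3" using card_tri u by blast
    have "h (tri u) \<in> tri u" using assms(1) u nt by blast
    then have sub: "{u, v, w, h (tri u)} \<subseteq> tri u" using u self_in_tri by simp
    have "card {u, v, w, h (tri u)} = 4" using u h ne by simp
    moreover have "card {u, v, w, h (tri u)} \<le> card (tri u)"
      using sub c by (intro card_mono) (simp_all add: card_ge_0_finite)
    ultimately show False using c by simp
  qed
qed

text \<open>A leg is a path of vertices outside triangles that connects two vertices of degree 3.\<close>

definition two_leg :: "('a \<times> 'a) set" where
  "two_leg = {(u, v). u \<in> V \<and> v \<in> V \<and> card (N u) = 3 \<and> card (N v) = 3 \<and>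
     (\<exists>d e. d \<in> N u \<and> e \<in> N d \<and> v \<in> N e \<and> card (N d) = 2 \<and> card (N e) = 2 \<and> tri d = {d} \<and> tri e = {e})}"

text \<open>The condition \<open>u \<noteq> v\<close> singles out the far end, since
  \<open>u\<close> is itself a neighbour of \<open>d\<close>.\<close>

definition one_leg :: "('a \<times> 'a) set" where
  "one_leg = {(u, v). u \<in> V \<and> v \<in> V \<and> card (N u) = 3 \<and> card (N v) = 3 \<and> u \<noteq> v \<and>
     (\<exists>d. d \<in> N u \<and> v \<in> N d \<and> card (N d) = 2 \<and> tri d = {d})}"

lemma other_nbr:
  assumes "card (N d) = 2" "u \<in> N d" "v \<in> N d" "w \<in> N d" "u \<noteq> v" "u \<noteq> w"
  shows "v = w"
proof -
  obtain x y where "N d = {x, y}" using assms(1) unfolding card_2_iff by blast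
  then show ?thesis using assms by auto
qed

text \<open>The leg at \<open>u\<close> starts in its only neighbour outside triangles and then runs
  through vertices of degree 2, so its far end is determined. A leg returning to \<open>u\<close>
  would give \<open>u\<close> two neighbours outside triangles.\<close>

lemma two_leg: "sym two_leg" "single_valued two_leg" "irrefl two_leg"
proof -
  show "sym two_leg"
  proof (rule symI)
    fix u v assume "(u, v) \<in> two_leg"
    then obtain d e where "u \<in> V" "v \<in> V" "card (N u) = 3" "card (N v) = 3"
      "d \<in> N u" "e \<in> N d" "v \<in> N e" "card (N d) = 2" "card (N e) = 2" "tri d = {d}" "tri e = {e}"
      unfolding two_leg_def by blast
    moreover from this have "u \<in> N d" "d \<in> N e" "e \<in> N v" using A(8,9) by blast+
    ultimately show "(v, u) \<in> two_leg" unfolding two_leg_def by blast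
  qed
  show "single_valued two_leg"
  proof (rule single_valuedI)
    fix u v w assume "(u, v) \<in> two_leg" "(u, w) \<in> two_leg"
    then obtain d e d' e' where *: "u \<in> V" "card (N u) = 3" "card (N v) = 3" "card (N w) = 3"
      "d \<in> N u" "e \<in> N d" "v \<in> N e" "card (N d) = 2" "card (N e) = 2" "tri d = {d}" "tri e = {e}"
      "d' \<in> N u" "e' \<in> N d'" "w \<in> N e'" "card (N d') = 2" "card (N e') = 2" "tri d' = {d'}" "tri e' = {e'}"
      unfolding two_leg_def by blast
    have d: "d = d'" using leg_unique * by metis
    have "u \<in> N d" "d \<in> N e" using A(8,9) * by blast+
    moreover have "u \<noteq> e" "u \<noteq> e'" using * by auto
    ultimately have e: "e = e'" using other_nbr[of d u e e'] * d by simp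
    have "d \<noteq> v" "d \<noteq> w" using * by auto
    then show "v = w" using other_nbr[of e d v w] \<open>d \<in> N e\<close> * e by simp
  qed
  show "irrefl two_leg"
  proof (rule irreflI)
    fix u show "(u, u) \<notin> two_leg"
    proof
      assume "(u, u) \<in> two_leg"
      then obtain d e where *: "u \<in> V" "card (N u) = 3"
        "d \<in> N u" "e \<in> N d" "u \<in> N e" "tri d = {d}" "tri e = {e}"
        unfolding two_leg_def by blast
      then have "d \<in> V" "e \<in> V" using A(9) by blast+
      then have "e \<in> N u" using A(8) * by blast
      then have "d = e" using leg_unique * by metis
      then show False using A(4)[OF \<open>d \<in> V\<close>] * by auto
    qed
  qed
qed

lemma one_leg: "sym one_leg" "single_valued one_leg" "irrefl one_leg"
proof -
  show "sym one_leg"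
  proof (rule symI)
    fix u v assume "(u, v) \<in> one_leg"
    then obtain d where "u \<in> V" "v \<in> V" "card (N u) = 3" "card (N v) = 3" "u \<noteq> v"
      "d \<in> N u" "v \<in> N d" "card (N d) = 2" "tri d = {d}"
      unfolding one_leg_def by blast
    moreover from this have "u \<in> N d" "d \<in> N v" using A(8,9) by blast+
    ultimately show "(v, u) \<in> one_leg" unfolding one_leg_def by blast
  qed
  show "single_valued one_leg"
  proof (rule single_valuedI)
    fix u v w assume "(u, v) \<in> one_leg" "(u, w) \<in> one_leg"
    then obtain d d' where *: "u \<in> V" "card (N u) = 3" "u \<noteq> v" "u \<noteq> w"
      "d \<in> N u" "v \<in> N d" "card (N d) = 2" "tri d = {d}"
      "d' \<in> N u" "w \<in> N d'" "tri d' = {d'}"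
      unfolding one_leg_def by blast
    have d: "d = d'" using leg_unique * by metis
    have "u \<in> N d" using A(8) * by blast
    then show "v = w" using other_nbr[of d u v w] * d by auto
  qed
  show "irrefl one_leg" by (auto simp: one_leg_def irrefl_def)
qed

section \<open>Coloring an irreducible graph\<close>

text \<open>A vertex of degree 3 marked \<open>red\<close> is one whose neighbour on the leg has
  color 3, so that it may take 0 itself. Of the two ends of a leg with two vertices exactly one is
  red. The second 2-coloring \<open>g\<close> distributes the colors 1 and 2.\<close>

lemma reduced_colorable: "colorable V N"
proof -
  \<comment> \<open>A triangle with a vertex of degree 2 can place 0 there; only full triangles need
    a red vertex.\<close>
  define full where "full = (\<lambda>T. \<forall>s\<in>T. card (N s) = 3)"
  \<comment> \<open>the vertex of a full triangle left out of the first matching\<close>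
  define exc :: "'a set \<Rightarrow> 'a" where "exc = (\<lambda>T. SOME s. s \<in> T)"
  have exc: "exc (tri t) \<in> tri t" for t
    unfolding exc_def using self_in_tri[of t] by (rule someI)
  define M1 where "M1 = {(u, v). u \<in> V \<and> v \<in> tri u \<and> u \<noteq> v \<and> u \<noteq> exc (tri u) \<and> v \<noteq> exc (tri u) \<and> full (tri u)}"
  have M1: "finite M1" "sym M1" "single_valued M1" "irrefl M1"
    unfolding M1_def by (rule matching_in_triangles; use exc in blast)+
  obtain red :: "'a \<Rightarrow> bool" where red: "\<forall>(u, v)\<in>M1 \<union> two_leg. red u \<noteq> red v"
    using two_matchings_2_colorable[OF M1 two_leg] by blast
  \<comment> \<open>the vertex of color 0\<close>
  define top where "top = (\<lambda>T. SOME y. y \<in> T \<and> (card (N y) = 2 \<or> red y))"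
  have top: "top (tri t) \<in> tri t \<and> (card (N (top (tri t))) = 2 \<or> red (top (tri t)))"
    if t: "t \<in> V" "tri t \<noteq> {t}" for t
  proof -
    have "\<exists>y. y \<in> tri t \<and> (card (N y) = 2 \<or> red y)"
    proof (cases "full (tri t)")
      case False
      then show ?thesis using deg_cases tri_mem[OF t(1)] unfolding full_def by blast
    next
      case True
      \<comment> \<open>The two vertices other than \<open>exc (tri t)\<close> are matched in
        \<open>M1\<close>, so exactly one of them is red.\<close>
      have c: "card (tri t - {exc (tri t)}) = 2"
        using card_tri[OF t(1)] t(2) exc[of t] by (simp add: card_Diff_singleton)
      then obtain u v where uv: "tri t - {exc (tri t)} = {u, v}" "u \<noteq> v" by (auto simp: card_2_iff)
      then have mem: "u \<in> tri t" "v \<in> tri t" "u \<noteq> exc (tri t)" "v \<noteq> exc (tri t)" by blast+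
      then have "(u, v) \<in> M1" using tri_mem[OF t(1)] uv(2) True by (auto simp: M1_def)
      then have "red u \<noteq> red v" using red by blast
      then show ?thesis using mem by blast
    qed
    then show ?thesis unfolding top_def by (rule someI_ex)
  qed
  \<comment> \<open>The conjunct \<open>True\<close> is the trivial selection \<open>Q\<close> of
    \<open>matching_in_triangles\<close>.\<close>
  define M3 where "M3 = {(u, v). u \<in> V \<and> v \<in> tri u \<and> u \<noteq> v \<and> u \<noteq> top (tri u) \<and> v \<noteq> top (tri u) \<and> True}"
  have M3: "finite M3" "sym M3" "single_valued M3" "irrefl M3"
    unfolding M3_def by (rule matching_in_triangles; use top in blast)+
  obtain g :: "'a \<Rightarrow> bool" where g: "\<forall>(u, v)\<in>M3 \<union> one_leg. g u \<noteq> g v"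
    using two_matchings_2_colorable[OF M3 one_leg] by blast
  \<comment> \<open>The only vertex of a one-vertex leg always gets 3. On a two-vertex leg the
    vertex next to \<open>u\<close> gets 3 if \<open>u\<close> is red and 0 otherwise.\<close>
  define f :: "'a \<Rightarrow> nat" where "f = (\<lambda>t. if tri t = {t}
      then if (\<exists>s\<in>N t. card (N s) = 2) \<and> (\<forall>s\<in>N t. card (N s) = 3 \<longrightarrow> \<not> red s) then 0 else 3
      else if t = top (tri t) then 0 else if g t then 1 else 2)"
  have f_leg: "f t = 0 \<or> f t = 3" if "tri t = {t}" for t using that by (simp add: f_def)
  have f_tri: "f t \<le> 2" if "tri t \<noteq> {t}" for t using that by (simp add: f_def)
  have f_distinct: "f u \<noteq> f v" if t: "t \<in> V" "u \<in> tri t" "v \<in> tri t" "u \<noteq> v" for t u v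
  proof -
    have eq: "u \<in> V" "tri u = tri t" "tri v = tri t" using tri_mem t by blast+
    have ne: "tri u \<noteq> {u}" "tri v \<noteq> {v}" using t eq by auto
    show ?thesis
    proof (cases "u = top (tri t) \<or> v = top (tri t)")
      case True
      then show ?thesis using t(4) ne eq by (auto simp: f_def)
    next
      case False
      then have "(u, v) \<in> M3" using t eq by (auto simp: M3_def)
      then have "g u \<noteq> g v" using g by blast
      then show ?thesis using False ne eq by (auto simp: f_def)
    qed
  qed
  have f_out: "f d \<noteq> f t" if t: "t \<in> V" "card (N t) = 3" "d \<in> N t" "tri d = {d}" for t d
  proof -
    have ne: "tri t \<noteq> {t}" using deg3_tri t by blast
    have td: "t \<in> N d" using A(8) t by blast
    have False if "f t = 0" "f d = 0"
    proof -
      have "t = top (tri t)" using \<open>f t = 0\<close> ne by (simp add: f_def split: if_splits)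
      then have "red t" using top[OF t(1) ne] t(2) by auto
      then show False using \<open>f d = 0\<close> td t by (auto simp: f_def split: if_splits)
    qed
    then show ?thesis using f_leg[OF t(4)] f_tri[OF ne] by auto
  qed
  have "valid_at N f t" if t: "t \<in> V" for t
    using t
  proof (cases rule: vertex_cases)
    case (deg3 a b d)
    have mem: "a \<in> tri t" "b \<in> tri t" "t \<noteq> a" "t \<noteq> b" using deg3 A(4)[OF t] by auto
    then have "tri a \<noteq> {a}" "tri b \<noteq> {b}" "tri t \<noteq> {t}" using tri_mem[OF t] deg3(5) by auto
    then have "f a \<le> 2" "f b \<le> 2" "f t \<le> 2" using f_tri by blast+
    moreover have "f t \<noteq> f a" "f t \<noteq> f b" "f a \<noteq> f b"
      using f_distinct[OF t] mem deg3(3) self_in_tri[of t] by blast+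
    moreover have "f d \<noteq> f t" using f_out[OF t] deg3 by auto
    moreover have "f d = 0 \<or> f d = 3" using f_leg deg3 by blast
    ultimately show ?thesis unfolding valid_at_def deg3(1) by auto
  next
    case (deg2 a b)
    have mem: "a \<in> tri t" "b \<in> tri t" "t \<noteq> a" "t \<noteq> b" using deg2 A(4)[OF t] by auto
    then have "tri t \<noteq> {t}" by auto
    then have "f t \<le> 2" by (rule f_tri)
    moreover have "f t \<noteq> f a" "f t \<noteq> f b" "f a \<noteq> f b"
      using f_distinct[OF t] mem deg2(3) self_in_tri[of t] by blast+
    ultimately show ?thesis unfolding valid_at_def deg2(1) by auto
  next
    case (leg x y)
    have "card (N x) = 3 \<or> card (N y) = 3"
      using no_path[OF t leg(1,3)] leg(4) deg_cases A(9)[OF t] leg(1) by auto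
    then obtain a b where ab: "N t = {a, b}" "a \<noteq> b" "card (N a) = 3" "a \<notin> N b"
      using leg A(8) A(9)[OF t] by (metis insertI1 insert_commute)
    have V: "a \<in> V" "b \<in> V" using A(9)[OF t] ab by auto
    have tN: "t \<in> N a" "t \<in> N b" using A(8)[OF t] ab by auto
    have fa: "f a \<le> 2" "f t \<noteq> f a"
      using f_tri deg3_tri V(1) ab f_out[OF V(1) ab(3) tN(1) leg(5)] by auto
    consider "card (N b) = 3" | "card (N b) = 2" using deg_cases[OF V(2)] by blast
    then show ?thesis
    proof cases
      case 1
      have fb: "f b \<le> 2" "f t \<noteq> f b"
        using f_tri deg3_tri V(2) ab f_out[OF V(2) 1 tN(2) leg(5)] 1 by auto
      \<comment> \<open>The two ends of this leg are at distance 2, and \<open>g\<close> keeps them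
        from sharing 1 or 2.\<close>
      have "(a, b) \<in> one_leg"
        unfolding one_leg_def using V ab tN 1 leg by auto
      then have "g a \<noteq> g b" using g by blast
      then have "f a = f b \<longrightarrow> f a = 0"
        using deg3_tri[OF V(1) ab(3)] deg3_tri[OF V(2) 1] by (auto simp: f_def)
      then show ?thesis unfolding valid_at_def ab(1) using fa fb f_leg[OF leg(5)] by auto
    next
      case 2
      have tb: "tri b = {b}" using leg_nbr[OF t leg(5) _ 2] ab by auto
      have "card (N b - {t}) = 1" using 2 tN(2) by simp
      then obtain c where "N b - {t} = {c}" by (auto simp: card_1_singleton_iff)
      then have c: "N b = {t, c}" "c \<noteq> t" using tN(2) by auto
      have cV: "c \<in> V" using A(9)[OF V(2)] c by auto
      have "card (N c) = 3"
      proof (rule ccontr)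
        assume "card (N c) \<noteq> 3"
        then have c2: "card (N c) = 2" using deg_cases[OF cV] by blast
        \<comment> \<open>Three consecutive vertices \<open>t\<close>, \<open>b\<close>,
          \<open>c\<close> of degree 2 would have to form a triangle, but the neighbour
          \<open>a\<close> of \<open>t\<close> has degree 3.\<close>
        have "t \<in> N c" using no_path[OF V(2) c(1) c(2)[symmetric] leg(2) c2] .
        then have "c \<in> N t" using A(8)[OF cV] by blast
        then have "c = b" using ab c2 by auto
        then show False using A(4)[OF V(2)] c by auto
      qed
      note c3 = this
      have bt: "b \<in> N t" and cb: "c \<in> N b" using ab c by auto
      have "(a, c) \<in> two_leg"
        unfolding two_leg_def using V cV ab(3) c3 tN(1) bt cb leg(2,5) 2 tb by blast
      then have rac: "red a \<noteq> red c" using red by blast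
      have "f t = (if red a then 3 else 0)"
        using leg(5) ab 2 by (auto simp: f_def)
      moreover have "f b = (if red c then 3 else 0)"
        using tb c c3 leg(2) by (auto simp: f_def)
      ultimately show ?thesis unfolding valid_at_def ab(1) using fa rac by auto
    qed
  qed
  then show ?thesis unfolding colorable_def by blast
qed

end

section \<open>Induction over the reductions\<close>

lemma remainder_singleton:
  assumes "finite B" "card B \<le> 3" "{a, b} \<subseteq> B" "a \<noteq> b"
  shows "\<exists>c. B - {a, b} \<subseteq> {c}"
proof -
  have "card (B - {a, b}) \<le> 1" using assms by (simp add: card_Diff_subset)
  moreover have "finite (B - {a, b})" using assms(1) by simp
  ultimately have eq: "\<And>c d. c \<in> B - {a, b} \<Longrightarrow> d \<in> B - {a, b} \<Longrightarrow> c = d"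
    by (metis One_nat_def card_le_Suc0_iff_eq)
  show ?thesis
  proof (cases "B - {a, b} = {}")
    case True
    then have "B - {a, b} \<subseteq> {a}" by (simp only: empty_subsetI)
    then show ?thesis ..
  next
    case False
    then obtain c where c: "c \<in> B - {a, b}" by (meson all_not_in_conv)
    have "B - {a, b} \<subseteq> {c}"
    proof
      fix d assume "d \<in> B - {a, b}"
      then show "d \<in> {c}" using eq[OF _ c, of d] by simp
    qed
    then show ?thesis ..
  qed
qed

lemma two_elements:
  assumes "finite B" "card B \<le> 2" "a \<in> B" "b \<in> B" "a \<noteq> b"
  shows "B = {a, b}"
  by (rule card_seteq[symmetric]) (use assms in simp_all)

lemma three_elements:
  assumes "finite B" "card B \<le> 3" "a \<in> B" "b \<in> B" "c \<in> B" "a \<noteq> b" "a \<noteq> c" "b \<noteq> c"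
  shows "B = {a, b, c}"
  by (rule card_seteq[symmetric]) (use assms in simp_all)

text \<open>The edge \<open>y w\<close> lies in no triangle, so the triangle at \<open>y\<close>
  uses its other two neighbours. As \<open>w\<close> has degree 3, one of these, called
  \<open>z\<close>, has degree at most 2 and hence no further neighbour; \<open>x\<close> has at
  most one, \<open>x'\<close>.\<close>

lemma triangle_beside_edge:
  assumes adm: "admissible V N" and y: "y \<in> V" "card (N y) = 3"
    and w: "w \<in> N y" "card (N w) = 3" and disj: "N y \<inter> N w = {}"
  obtains (triangle) x z x' where "N y = {x, z, w}" "N z = {x, y}" "distinct [x, y, z, w]"
    "{y, z} \<subseteq> N x" "N x - {y, z} \<subseteq> {x'}"
proof -
  note A = admissibleD[OF adm]
  have *: thesis
    if xz: "x \<in> N y" "z \<in> N y" "x \<in> N z" and low: "card (N z) \<le> 2" for x z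
  proof -
    have V: "x \<in> V" "z \<in> V" using A(9) y xz by blast+
    have zx: "z \<in> N x" using A(8)[OF V(2) xz(3)] .
    have ne: "x \<noteq> z" "x \<noteq> y" "z \<noteq> y" "w \<noteq> y"
      using A(4)[OF V(2)] A(4)[OF y(1)] xz w(1) by auto
    have nw: "x \<noteq> w" "z \<noteq> w" using disj xz zx by auto
    have yx: "y \<in> N x" "y \<in> N z" using A(8)[OF y(1)] xz by auto
    have Ny: "N y = {x, z, w}"
      using three_elements[OF A(3)[OF y(1)] A(5)[OF y(1)] xz(1,2) w(1) ne(1) nw] .
    have Nz: "N z = {x, y}"
      using two_elements[OF A(3)[OF V(2)] low xz(3) yx(2) ne(2)] .
    obtain x' where x': "N x - {y, z} \<subseteq> {x'}"
      using remainder_singleton[OF A(3)[OF V(1)] A(5)[OF V(1)], of y z] yx zx ne by auto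
    show ?thesis by (rule triangle[OF Ny Nz _ _ x']) (use ne nw yx zx in auto)
  qed
  obtain x z where xz: "x \<in> N y" "z \<in> N y" "x \<in> N z" using A(6)[OF y] by blast
  have zV: "z \<in> V" using A(9) y xz by blast
  have zx: "z \<in> N x" using A(8)[OF zV xz(3)] .
  have "x \<noteq> z" using A(4)[OF zV] xz by auto
  moreover have "x \<noteq> w" "z \<noteq> w" using disj xz zx by auto
  ultimately have Ny: "N y = {x, z, w}"
    using three_elements[OF A(3)[OF y(1)] A(5)[OF y(1)] xz(1,2) w(1)] by blast
  obtain u where "u \<in> N y" "card (N u) \<le> 2" using A(7)[OF y] by blast
  then have "card (N x) \<le> 2 \<or> card (N z) \<le> 2" using Ny w(2) by auto
  then show ?thesis
  proof
    assume "card (N z) \<le> 2"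
    then show ?thesis by (rule *[OF xz])
  next
    assume "card (N x) \<le> 2"
    then show ?thesis by (rule *[OF xz(2,1) zx])
  qed
qed

text \<open>The adjacency is generalized along with the vertex set, because contraction and
  replacement change it. The negated case distinctions supply the assumptions of
  \<open>reduced\<close>.\<close>

lemma colorable_if_admissible:
  fixes V :: "'a set"
  assumes "admissible V N"
  shows "colorable V N"
  using assms
proof (induction "card V" arbitrary: V N rule: less_induct)
  case less
  note adm = less.prems and smaller = less.hyps
  note A = admissibleD[OF adm]
  have del: "colorable W (\<lambda>s. N s \<inter> W)" if "W \<subset> V" for W
    using smaller[OF psubset_card_mono[OF A(1) that]] admissible_induced[OF adm] that by blast
  show ?case
  proof (cases "\<exists>t\<in>V. card (N t) \<le> 1")
    case True
    then obtain t where t: "t \<in> V" "card (N t) \<le> 1" by blast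
    have "V - {t} \<subset> V" using t by auto
    then show ?thesis by (rule colorable_delete_vertex[OF adm t del])
  next
    case no_leaf: False
    show ?thesis
    proof (cases "\<exists>v\<in>V. \<exists>u w. N v = {u, w} \<and> u \<noteq> w \<and> card (N u) = 2 \<and> card (N w) = 2 \<and> u \<notin> N w")
      case True
      then obtain v u w where v: "v \<in> V" "N v = {u, w}" "u \<noteq> w"
        and c: "card (N u) = 2" "card (N w) = 2" and uw: "u \<notin> N w" by blast
      have "v \<in> N u" "v \<in> N w" using A(8)[OF v(1)] v by auto
      then have "card (N u - {v}) = 1" "card (N w - {v}) = 1" using c by simp_all
      then obtain u2 w2 where "N u - {v} = {u2}" "N w - {v} = {w2}"
        by (auto simp: card_1_singleton_iff)
      then have 2: "N u = {v, u2}" "u2 \<noteq> v" "N w = {v, w2}" "w2 \<noteq> v"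
        using \<open>v \<in> N u\<close> \<open>v \<in> N w\<close> by auto
      note contract = colorable_contract_path[OF adm v 2 uw]
      have "card (V - {v}) < card V" using v(1) A(1) by (intro card_Diff1_less)
      then show ?thesis by (rule contract(2)[OF smaller[OF _ contract(1)]])
    next
      case no_path: False
      show ?thesis
      proof (cases "\<exists>u\<in>V. \<exists>v\<in>N u. \<exists>a\<in>N u \<inter> N v. \<exists>b\<in>N u \<inter> N v. a \<noteq> b")
        case True
        then obtain u v a b where u: "u \<in> V" "v \<in> N u" and ab: "a \<in> N u" "a \<in> N v" "b \<in> N u" "b \<in> N v" "a \<noteq> b"
          by blast
        have V: "v \<in> V" "a \<in> V" "b \<in> V" using A(9) u ab by blast+
        have uv: "u \<in> N v" "u \<noteq> v" using A(8)[OF u] A(4)[OF u(1)] u(2) by auto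
        have ne: "v \<noteq> a" "v \<noteq> b" "u \<noteq> a" "u \<noteq> b"
          using A(4)[OF V(1)] A(4)[OF u(1)] ab by auto
        have Nu: "N u = {v, a, b}"
          using three_elements[OF A(3)[OF u(1)] A(5)[OF u(1)] u(2) ab(1,3) ne(1,2) ab(5)] .
        have Nv: "N v = {u, a, b}"
          using three_elements[OF A(3)[OF V(1)] A(5)[OF V(1)] uv(1) ab(2,4) ne(3,4) ab(5)] .
        have "card (N u) = 3" "card (N v) = 3" using Nu Nv ne ab(5) by simp_all
        \<comment> \<open>The vertex \<open>u\<close> has a neighbour of degree at most 2, and
          \<open>v\<close> has degree 3.\<close>
        then have low: "card (N a) \<le> 2 \<or> card (N b) \<le> 2" using A(7)[OF u(1)] Nu by auto
        have mem: "u \<in> N a" "v \<in> N a" "u \<in> N b" "v \<in> N b"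
          using A(8) u(1) V ab by blast+
        from low show ?thesis
        proof
          assume "card (N a) \<le> 2"
          then have Na: "N a = {u, v}"
            using two_elements[OF A(3)[OF V(2)] _ mem(1,2) uv(2)] by simp
          have "V - {u, v, a} \<subset> V" using u(1) by auto
          then show ?thesis
            by (rule colorable_delete_diamond[OF adm u(1) V Nu Nv Na ab(5) del])
        next
          assume "card (N b) \<le> 2"
          then have Nb: "N b = {u, v}"
            using two_elements[OF A(3)[OF V(3)] _ mem(3,4) uv(2)] by simp
          have Nu': "N u = {v, b, a}" and Nv': "N v = {u, b, a}" using Nu Nv by auto
          have "V - {u, v, b} \<subset> V" using u(1) by auto
          then show ?thesis
            by (rule colorable_delete_diamond[OF adm u(1) V(1,3,2) Nu' Nv' Nb ab(5)[symmetric] del])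
        qed
      next
        case no_diamond: False
        show ?thesis
        proof (cases "\<exists>y\<in>V. \<exists>w\<in>N y. card (N y) = 3 \<and> card (N w) = 3 \<and> N y \<inter> N w = {}")
          case True
          then obtain y w where y: "y \<in> V" "card (N y) = 3" and w: "w \<in> N y" "card (N w) = 3"
            and disj: "N y \<inter> N w = {}" by blast
          have wV: "w \<in> V" and yw: "y \<in> N w" using A(8,9) y w by blast+
          obtain x z x' where x: "N y = {x, z, w}" "N z = {x, y}" "distinct [x, y, z, w]"
            "{y, z} \<subseteq> N x" "N x - {y, z} \<subseteq> {x'}"
            by (rule triangle_beside_edge[OF adm y w disj])
          have disj': "N w \<inter> N y = {}" using disj by blast
          obtain p q p' where p: "N w = {p, q, y}" "N q = {p, w}" "distinct [p, w, q, y]"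
            "{w, q} \<subseteq> N p" "N p - {w, q} \<subseteq> {p'}"
            by (rule triangle_beside_edge[OF adm wV w(2) yw y(2) disj'])
          have dist: "distinct [x, y, z, w, p, q]" using x(1,3) p(1,3) disj by auto
          have Nq: "N q = {w, p}" using p(2) by auto
          have Nx: "N x = {y, z} \<union> (N x - {y, z})" "(N x - {y, z}) \<inter> {y, z} = {}" using x(4) by auto
          have Np: "N p = {w, q} \<union> (N p - {w, q})" "(N p - {w, q}) \<inter> {w, q} = {}" using p(4) by auto
          show ?thesis
            by (rule colorable_replace_triangle_pair[OF adm y(1) wV x(1) p(1) x(2) Nq
                  Nx x(5) Np p(5) dist smaller])
        next
          case no_pair: False
          interpret reduced V N
          proof
            show "admissible V N" by (rule adm)
            show "2 \<le> card (N t)" if "t \<in> V" for t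
            proof -
              have "\<not> card (N t) \<le> 1" using no_leaf that by blast
              then show ?thesis by simp
            qed
            show "u \<in> N w" if "v \<in> V" "N v = {u, w}" "u \<noteq> w" "card (N u) = 2" "card (N w) = 2" for v u w
              using no_path that by blast
            show "a = b" if "u \<in> V" "v \<in> N u" "a \<in> N u \<inter> N v" "b \<in> N u \<inter> N v" for u v a b
              using no_diamond that by blast
            show "N u \<inter> N v \<noteq> {}" if "u \<in> V" "v \<in> N u" "card (N u) = 3" "card (N v) = 3" for u v
              using no_pair that by blast
          qed
          show ?thesis by (rule reduced_colorable)
        qed
      qed
    qed
  qed
qed

section \<open>Packing colorings\<close>

context graph
begin

definition nbrs :: "'a \<Rightarrow> 'a set" where
  "nbrs v = {u. v \<rightarrow>\<^bsub>G\<^esub> u}"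

lemma nbrs_subset: "nbrs v \<subseteq> verts G"
  using adj_in_verts by (auto simp: nbrs_def)

lemma nbrs_sym: "u \<in> nbrs v \<longleftrightarrow> v \<in> nbrs u"
  using arcs_ends_symmetric[OF sym_arcs] by (auto simp: nbrs_def)

lemma nbrs_irrefl: "v \<notin> nbrs v"
  using adj_not_same by (auto simp: nbrs_def)

lemma card_nbrs: "card (nbrs v) = vdegree G v"
proof -
  have "nbrs v = head G ` out_arcs G v"
    by (auto simp: nbrs_def arcs_ends_conv)
  moreover have "inj_on (head G) (out_arcs G v)"
    by (rule inj_onI) (auto intro!: no_multi_arcs simp: arc_to_ends_def)
  ultimately show ?thesis by (simp add: card_image out_degree_def)
qed

text \<open>If every cycle through \<open>v\<close> had length at least 4, so would the infimum.
  Hence there is a cycle of length exactly 3 through \<open>v\<close>.\<close>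

lemma local_girth_triangle:
  assumes "local_girth G v \<le> 3"
  shows "\<exists>u\<in>nbrs v. \<exists>w\<in>nbrs v. u \<in> nbrs w"
proof -
  define P where "P = {p. undirected_cycle G p \<and> v \<in> tail G ` set p}"
  have "\<exists>p\<in>P. length p \<le> 3"
  proof (rule ccontr)
    assume "\<not> ?thesis"
    then have "\<And>p. p \<in> P \<Longrightarrow> 4 \<le> length p" by (metis not_less_eq_eq numeral_3_eq_3 eval_nat_numeral(2) semiring_norm(26,27))
    then have "4 \<le> (INF p\<in>P. enat (length p))"
      by (intro INF_greatest) (simp add: numeral_eq_enat)
    then have "4 \<le> local_girth G v" by (simp add: local_girth_def P_def)
    then have "(4 :: enat) \<le> 3" using assms by (rule order_trans)
    then show False by (simp add: numeral_eq_enat)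
  qed
  then obtain p where p: "cycle p" "length p = 3" "v \<in> tail G ` set p"
    unfolding P_def undirected_cycle_def by force
  then obtain u where u: "awalk u p u" unfolding cycle_def by blast
  obtain e1 e2 e3 where e: "p = [e1, e2, e3]" using p(2) by (auto simp: numeral_3_eq_3 length_Suc_conv)
  have arcs: "e1 \<in> arcs G" "e2 \<in> arcs G" "e3 \<in> arcs G"
    and ends: "tail G e1 = u" "head G e1 = tail G e2" "head G e2 = tail G e3" "head G e3 = u"
    using u unfolding e by (auto simp: awalk_def)
  have dom: "tail G e \<rightarrow>\<^bsub>G\<^esub> head G e" if "e \<in> arcs G" for e
    using that by (auto simp: arcs_ends_conv)
  have "tail G e2 \<in> nbrs u" "tail G e3 \<in> nbrs (tail G e2)" "u \<in> nbrs (tail G e3)"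
    using dom[OF arcs(1)] dom[OF arcs(2)] dom[OF arcs(3)] ends by (simp_all add: nbrs_def)
  moreover have "v = u \<or> v = tail G e2 \<or> v = tail G e3" using p(3) e ends by auto
  ultimately show ?thesis using nbrs_sym by metis
qed

lemma walk_nbrs:
  assumes "awalk u p v" "u \<noteq> v"
  shows "1 \<le> length p" and "length p = 1 \<Longrightarrow> v \<in> nbrs u"
    and "length p = 2 \<Longrightarrow> \<exists>w. u \<in> nbrs w \<and> v \<in> nbrs w"
proof -
  have dom: "head G e \<in> nbrs (tail G e)" if "e \<in> arcs G" for e
    using that by (auto simp: arcs_ends_conv nbrs_def)
  show "1 \<le> length p" using assms by (cases p) (auto simp: awalk_def)
  show "v \<in> nbrs u" if len: "length p = 1"
  proof -
    obtain e where "p = [e]"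
      using len by (auto simp: length_Suc_conv)
    then show ?thesis using assms dom[of e] by (auto simp: awalk_def)
  qed
  show "\<exists>w. u \<in> nbrs w \<and> v \<in> nbrs w" if len: "length p = 2"
  proof -
    obtain e e' where "p = [e, e']" using len by (auto simp: numeral_2_eq_2 length_Suc_conv)
    then have "head G e \<in> nbrs u" "v \<in> nbrs (head G e)"
      using assms dom[of e] dom[of e'] by (auto simp: awalk_def)
    then show ?thesis using nbrs_sym by blast
  qed
qed

text \<open>The distance is an infimum of walk lengths, infinite if there is no walk. The bound
  \<open>Suc k\<close> passes to the infimum and makes the inequality with \<open>k\<close>
  strict.\<close>

lemma graph_dist_greater:
  assumes "\<And>p. awalk u p v \<Longrightarrow> Suc k \<le> length p"
  shows "ereal (real k) < graph_dist G u v"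
proof -
  have "awalk_cost (\<lambda>_. 1) p = real (length p)" for p
    by (induction p) auto
  then have "ereal (real (Suc k)) \<le> graph_dist G u v"
    unfolding \<mu>_def using assms by (intro INF_greatest) (simp add: of_nat_Suc[symmetric] del: of_nat_Suc)
  then show ?thesis by (rule less_le_trans[rotated]) simp
qed

end

text \<open>A walk of length 1 between vertices of equal color violates validity at an end, and one
  of length 2 in a nonzero color violates it at the middle vertex.\<close>

lemma (in graph) packing_colorable_1222:
  assumes f: "\<And>t. t \<in> verts G \<Longrightarrow> valid_at nbrs f t"
  shows "packing_colorable [1, 2, 2, 2] G"
proof -
  define V where "V = (\<lambda>i. {v \<in> verts G. f v = i})"
  have "packing_coloring [1, 2, 2, 2] G V"
    unfolding packing_coloring_def
  proof (intro conjI allI impI ballI)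
    show "(\<Union>i<length [1, 2, 2, 2 :: nat]. V i) = verts G"
      using f by (auto simp: V_def valid_at_def eval_nat_numeral)
    show "disjoint_family_on V {..<length [1, 2, 2, 2 :: nat]}"
      by (auto simp: disjoint_family_on_def V_def)
    fix i u v assume i: "i < length [1, 2, 2, 2 :: nat]" and u: "u \<in> V i" and v: "v \<in> V i" and ne: "u \<noteq> v"
    have uv: "u \<in> verts G" "v \<in> verts G" "f u = i" "f v = i" using u v by (auto simp: V_def)
    have adj: "v \<notin> nbrs u" using f[OF uv(1)] uv unfolding valid_at_def by metis
    show "ereal (real ([1, 2, 2, 2] ! i)) < graph_dist G u v"
    proof (cases "i = 0")
      case True
      have "Suc 1 \<le> length p" if "awalk u p v" for p
        using walk_nbrs(1,2)[OF that ne] adj by (cases "length p = 1") auto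
      then show ?thesis using True graph_dist_greater[of u v 1] by simp
    next
      case False
      have common: "\<not> (u \<in> nbrs w \<and> v \<in> nbrs w)" for w
      proof
        assume w: "u \<in> nbrs w \<and> v \<in> nbrs w"
        then have "w \<in> verts G" using nbrs_sym nbrs_subset by blast
        then show False using f[of w] w ne uv False unfolding valid_at_def by metis
      qed
      have "Suc 2 \<le> length p" if "awalk u p v" for p
      proof -
        have "length p \<noteq> 1" "length p \<noteq> 2" using walk_nbrs(2,3)[OF that ne] adj common by blast+
        then show ?thesis using walk_nbrs(1)[OF that ne] by linarith
      qed
      then have "ereal (real 2) < graph_dist G u v" by (rule graph_dist_greater)
      moreover have "[1, 2, 2, 2] ! i = (2 :: nat)"
        using i False by (auto simp: less_Suc_eq numeral_2_eq_2 numeral_3_eq_3)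
      ultimately show ?thesis by simp
    qed
  qed
  then show ?thesis unfolding packing_colorable_def by blast
qed

theorem theorem4:
  fixes G :: "('a, 'b) pre_digraph"
  assumes "graph G"
    and "subcubic G"
    and "saturated 2 G"
    and "g3 G = 3"
  shows "packing_colorable [1, 2, 2, 2] G"
proof -
  interpret graph G by fact
  have "admissible (verts G) nbrs"
    unfolding admissible_def
  proof (intro conjI ballI impI)
    show "finite (verts G)" by simp
    fix t assume t: "t \<in> verts G"
    show "nbrs t \<subseteq> verts G" by (rule nbrs_subset)
    show "t \<notin> nbrs t" by (rule nbrs_irrefl)
    show "card (nbrs t) \<le> 3" using assms(2) t by (simp add: subcubic_def card_nbrs)
    {
      assume c: "card (nbrs t) = 3"
      then have d: "vdegree G t = 3" by (simp add: card_nbrs)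
      \<comment> \<open>As \<open>g3\<close> is a supremum, the value 3 bounds the local girth at
        every vertex of degree 3 and so puts each of them in a triangle.\<close>
      have "local_girth G t \<le> g3 G"
        unfolding g3_def using t d by (intro SUP_upper) simp
      then show "\<exists>u\<in>nbrs t. \<exists>w\<in>nbrs t. u \<in> nbrs w"
        using local_girth_triangle assms(4) by simp
      show "\<exists>u\<in>nbrs t. card (nbrs u) \<le> 2"
      proof (rule ccontr)
        assume "\<not> ?thesis"
        then have *: "card (nbrs u) = 3" if "u \<in> nbrs t" for u
          using that nbrs_subset[of t] assms(2) unfolding subcubic_def card_nbrs[symmetric] by force
        then have "{u \<in> verts G. t \<rightarrow>\<^bsub>G\<^esub> u \<and> vdegree G u = 3} = nbrs t"
          using nbrs_subset[of t] unfolding card_nbrs[symmetric] by (auto simp: nbrs_def)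
        moreover have "card {u \<in> verts G. t \<rightarrow>\<^bsub>G\<^esub> u \<and> vdegree G u = 3} \<le> 2"
          using assms(3) t d by (simp add: saturated_def)
        ultimately show False using c by simp
      qed
    }
  next
    fix u w assume "u \<in> nbrs w"
    then show "w \<in> nbrs u" using nbrs_sym by blast
  qed
  then show ?thesis
    using colorable_if_admissible packing_colorable_1222 unfolding colorable_def by blast
qed

end
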